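(* There is no $3$-dimensional proper CR submanifold $M$ of the nearly Kähler manifold $(\mathbb{S}^3\times\mathbb{S}^3,g,J)$ such that $P\mathcal{D}_1=\mathcal{D}_1$ and $P\mathcal{D}_2=\mathcal{D}_3$ (equalities holding at every point of $M$).
   Context: Identify $\mathbb{S}^3$ with the unit quaternions in $\mathbb{H}=\mathbb{R}^4$. A tangent vector of $\mathbb{S}^3\times\mathbb{S}^3$ at $(p,q)$ is written $Z=(p\alpha,q\beta)$ with $\alpha,\beta\in\mathrm{Im}\,\mathbb{H}$. The almost complex structure is $J(p\alpha,q\beta)=\frac{1}{\sqrt3}\big(p(2\beta-\alpha),q(-2\alpha+\beta)\big)$, and the nearly Kähler metric is $g(Z,Z')=\frac12(\langle Z,Z'\rangle+\langle JZ,JZ'\rangle)$, where $\langle\cdot,\cdot\rangle$ is the standard product metric induced from $\mathbb{R}^4\times\mathbb{R}^4$. Let $\widetilde\nabla$ be the Levi-Civita connection of $g$ and $G(X,Y)=(\widetilde\nabla_XJ)Y$, a skew-symmetric tensor. The almost product structure $P$ is $P(p\alpha,q\beta)=(p\beta,q\alpha)$. All objects are smooth. A submanifold $M$ is a CR submanifold if there is a smooth distribution $\mathcal{D}_1\subseteq TM$ with $J\mathcal{D}_1=\mathcal{D}_1$ whose $g$-orthogonal complement $\mathcal{D}_1^\perp$ in $TM$ is totally real, i.e. $J\mathcal{D}_1^\perp\subseteq T^\perp M$. It is proper if it is neither almost complex nor totally real. For a $3$-dimensional proper CR submanifold, $\mathcal{D}_1=JTM\cap TM$ has rank $2$ and $\mathcal{D}_1^\perp$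 has rank $1$. Along such $M$ put $\mathcal{D}_2=\mathcal{D}_1^\perp\oplus J\mathcal{D}_1^\perp$ and $\mathcal{D}_3=G(\mathcal{D}_1,\mathcal{D}_2)$. These are $J$-invariant rank-$2$ bundles over $M$, and $T(\mathbb{S}^3\times\mathbb{S}^3)|_M=\mathcal{D}_1\oplus\mathcal{D}_2\oplus\mathcal{D}_3$ is a $g$-orthogonal decomposition. *)

theory Defs
  imports "HOL-Analysis.Analysis"
begin

section \<open>Smooth maps on open sets\<close>

primrec Ck_on :: "nat \<Rightarrow> ('a::euclidean_space \<Rightarrow> 'b::euclidean_space) \<Rightarrow> 'a set \<Rightarrow> bool" where
  "Ck_on 0 f U \<longleftrightarrow> continuous_on U f"
| "Ck_on (Suc k) f U \<longleftrightarrow>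
     (\<forall>x\<in>U. f differentiable (at x)) \<and> (\<forall>v. Ck_on k (\<lambda>x. frechet_derivative f (at x) v) U)"

text \<open>Only used for open \<open>U\<close>.\<close>

definition smooth_on :: "('a::euclidean_space \<Rightarrow> 'b::euclidean_space) \<Rightarrow> 'a set \<Rightarrow> bool" where
  "smooth_on f U \<longleftrightarrow> (\<forall>k. Ck_on k f U)"

section \<open>Quaternions\<close>

text \<open>A quaternion is the pair of its real part and its imaginary part; the inner product and the
  norm of the product type are those of \<open>\<real>\<^sup>4\<close>.\<close>

type_synonym quat = "real \<times> (real^3)"

definition qmult :: "quat \<Rightarrow> quat \<Rightarrow> quat" (infixl "\<odot>" 70) where
  "x \<odot> y = (fst x * fst y - inner (snd x) (snd y),
            fst x *\<^sub>R snd y + fst y *\<^sub>R snd x + cross3 (snd x) (snd y))"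

definition qcnj :: "quat \<Rightarrow> quat" where
  "qcnj x = (fst x, - snd x)"

definition Im_quat :: "quat set" where
  "Im_quat = {x. fst x = 0}"

section \<open>The nearly Kaehler structure on the product of two 3-spheres\<close>

type_synonym quat2 = "quat \<times> quat"

definition S3S3 :: "quat2 set" where
  "S3S3 = sphere 0 1 \<times> sphere 0 1"

definition tangent_S3S3 :: "quat2 \<Rightarrow> quat2 set" where
  "tangent_S3S3 z = {(fst z \<odot> \<alpha>, snd z \<odot> \<beta>) | \<alpha> \<beta>. \<alpha> \<in> Im_quat \<and> \<beta> \<in> Im_quat}"

text \<open>For \<open>Z = (p\<alpha>, q\<beta>)\<close> tangent at \<open>z = (p, q)\<close>, the components \<open>\<alpha>\<close> and \<open>\<beta>\<close> are recovered by
  multiplying by the conjugates of the unit quaternions \<open>p\<close> and \<open>q\<close>.\<close>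

definition nk_J :: "quat2 \<Rightarrow> quat2 \<Rightarrow> quat2" where
  "nk_J z Z =
     (let p = fst z; q = snd z; \<alpha> = qcnj p \<odot> fst Z; \<beta> = qcnj q \<odot> snd Z
      in (1 / sqrt 3) *\<^sub>R (p \<odot> (2 *\<^sub>R \<beta> - \<alpha>), q \<odot> (- 2 *\<^sub>R \<alpha> + \<beta>)))"

definition nk_P :: "quat2 \<Rightarrow> quat2 \<Rightarrow> quat2" where
  "nk_P z Z =
     (let p = fst z; q = snd z; \<alpha> = qcnj p \<odot> fst Z; \<beta> = qcnj q \<odot> snd Z
      in (p \<odot> \<beta>, q \<odot> \<alpha>))"

definition nk_g :: "quat2 \<Rightarrow> quat2 \<Rightarrow> quat2 \<Rightarrow> real" where
  "nk_g z Z W = (1/2) * (inner Z W + inner (nk_J z Z) (nk_J z W))"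

text \<open>Smooth functions and vector fields on the compact submanifold \<open>S3S3\<close> are represented by smooth
  extensions to the ambient space (these always exist). Only values at points of \<open>S3S3\<close>, and
  derivatives there in directions tangent to \<open>S3S3\<close>, are ever used, so the choice of the extension
  is irrelevant.\<close>

definition vector_fields :: "(quat2 \<Rightarrow> quat2) set" where
  "vector_fields = {X. smooth_on X UNIV \<and> (\<forall>z\<in>S3S3. X z \<in> tangent_S3S3 z)}"

definition lie_bracket :: "(quat2 \<Rightarrow> quat2) \<Rightarrow> (quat2 \<Rightarrow> quat2) \<Rightarrow> quat2 \<Rightarrow> quat2" where
  "lie_bracket X Y z = frechet_derivative Y (at z) (X z) - frechet_derivative X (at z) (Y z)"

type_synonym connection = "(quat2 \<Rightarrow> quat2) \<Rightarrow> (quat2 \<Rightarrow> quat2) \<Rightarrow> quat2 \<Rightarrow> quat2"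

definition affine_connection :: "connection \<Rightarrow> bool" where
  "affine_connection nabla \<longleftrightarrow>
     (\<forall>X\<in>vector_fields. \<forall>Y\<in>vector_fields. nabla X Y \<in> vector_fields) \<and>
     (\<forall>X\<in>vector_fields. \<forall>Y\<in>vector_fields. \<forall>Z\<in>vector_fields. \<forall>f :: quat2 \<Rightarrow> real.
        smooth_on f UNIV \<longrightarrow> (\<forall>z\<in>S3S3.
          nabla (\<lambda>w. X w + Y w) Z z = nabla X Z z + nabla Y Z z \<and>
          nabla (\<lambda>w. f w *\<^sub>R X w) Z z = f z *\<^sub>R nabla X Z z \<and>
          nabla X (\<lambda>w. Y w + Z w) z = nabla X Y z + nabla X Z z \<and>
          nabla X (\<lambda>w. f w *\<^sub>R Y w) z =
            f z *\<^sub>R nabla X Y z + frechet_derivative f (at z) (X z) *\<^sub>R Y z))"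

definition torsion_free :: "connection \<Rightarrow> bool" where
  "torsion_free nabla \<longleftrightarrow>
     (\<forall>X\<in>vector_fields. \<forall>Y\<in>vector_fields. \<forall>z\<in>S3S3.
        nabla X Y z - nabla Y X z = lie_bracket X Y z)"

definition metric_connection :: "connection \<Rightarrow> bool" where
  "metric_connection nabla \<longleftrightarrow>
     (\<forall>X\<in>vector_fields. \<forall>Y\<in>vector_fields. \<forall>Z\<in>vector_fields. \<forall>z\<in>S3S3.
        frechet_derivative (\<lambda>w. nk_g w (Y w) (Z w)) (at z) (X z) =
          nk_g z (nabla X Y z) (Z z) + nk_g z (Y z) (nabla X Z z))"

definition levi_civita :: "connection \<Rightarrow> bool" where
  "levi_civita nabla \<longleftrightarrow>
     affine_connection nabla \<and> torsion_free nabla \<and> metric_connection nabla"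

definition nk_G :: "connection \<Rightarrow> (quat2 \<Rightarrow> quat2) \<Rightarrow> (quat2 \<Rightarrow> quat2) \<Rightarrow> quat2 \<Rightarrow> quat2" where
  "nk_G nabla X Y z = nabla X (\<lambda>w. nk_J w (Y w)) z - nk_J z (nabla X Y z)"

section \<open>Three-dimensional immersed submanifolds\<close>

text \<open>An immersed 3-manifold is a topological space \<open>T\<close> with a map \<open>\<iota>\<close> into the ambient space that is
  a smooth immersion in suitable local parametrizations \<open>\<phi>\<close> of \<open>T\<close> by open subsets of \<open>\<real>\<^sup>3\<close>. Any two such
  parametrizations are smoothly compatible (an immersion is locally an embedding), so the smooth
  structure need not be given separately. Embedded submanifolds \<open>M\<close> are the case \<open>T = top_of_set M\<close>,
  \<open>\<iota> = id\<close>.\<close>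

definition param :: "'m topology \<Rightarrow> ('m \<Rightarrow> quat2) \<Rightarrow> (real^3) set \<Rightarrow> (real^3 \<Rightarrow> 'm) \<Rightarrow> bool" where
  "param T \<iota> U \<phi> \<longleftrightarrow>
     open U \<and> embedding_map (top_of_set U) T \<phi> \<and> openin T (\<phi> ` U) \<and>
     smooth_on (\<iota> \<circ> \<phi>) U \<and> (\<forall>u\<in>U. inj (frechet_derivative (\<iota> \<circ> \<phi>) (at u)))"

definition submanifold3 :: "'m topology \<Rightarrow> ('m \<Rightarrow> quat2) \<Rightarrow> bool" where
  "submanifold3 T \<iota> \<longleftrightarrow>
     Hausdorff_space T \<and> second_countable T \<and> \<iota> ` topspace T \<subseteq> S3S3 \<and>
     (\<forall>x\<in>topspace T. \<exists>U \<phi>. param T \<iota> U \<phi> \<and> x \<in> \<phi> ` U)"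

text \<open>Tangent spaces, and all distributions below, are regarded as subspaces of the tangent space of
  \<open>S3S3\<close> at \<open>\<iota> x\<close>.\<close>

definition tangent :: "'m topology \<Rightarrow> ('m \<Rightarrow> quat2) \<Rightarrow> 'm \<Rightarrow> quat2 set" where
  "tangent T \<iota> x =
     {frechet_derivative (\<iota> \<circ> \<phi>) (at u) v | U \<phi> u v. param T \<iota> U \<phi> \<and> u \<in> U \<and> \<phi> u = x}"

definition normal :: "'m topology \<Rightarrow> ('m \<Rightarrow> quat2) \<Rightarrow> 'm \<Rightarrow> quat2 set" where
  "normal T \<iota> x = {v \<in> tangent_S3S3 (\<iota> x). \<forall>w\<in>tangent T \<iota> x. nk_g (\<iota> x) v w = 0}"

definition smooth_distribution ::
    "'m topology \<Rightarrow> ('m \<Rightarrow> quat2) \<Rightarrow> ('m \<Rightarrow> quat2 set) \<Rightarrow> bool" where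
  "smooth_distribution T \<iota> D \<longleftrightarrow>
     (\<exists>k. \<forall>x\<in>topspace T. \<exists>U \<phi> (e :: nat \<Rightarrow> real^3 \<Rightarrow> quat2).
        param T \<iota> U \<phi> \<and> x \<in> \<phi> ` U \<and> (\<forall>i<k. smooth_on (e i) U) \<and>
        (\<forall>u\<in>U. D (\<phi> u) = span ((\<lambda>i. e i u) ` {..<k}) \<and> dim (D (\<phi> u)) = k \<and>
                D (\<phi> u) \<subseteq> tangent T \<iota> (\<phi> u)))"

definition complement_in_tangent ::
    "'m topology \<Rightarrow> ('m \<Rightarrow> quat2) \<Rightarrow> ('m \<Rightarrow> quat2 set) \<Rightarrow> 'm \<Rightarrow> quat2 set" where
  "complement_in_tangent T \<iota> D x = {v \<in> tangent T \<iota> x. \<forall>w\<in>D x. nk_g (\<iota> x) v w = 0}"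

section \<open>CR submanifolds\<close>

definition CR_submanifold :: "'m topology \<Rightarrow> ('m \<Rightarrow> quat2) \<Rightarrow> bool" where
  "CR_submanifold T \<iota> \<longleftrightarrow>
     submanifold3 T \<iota> \<and>
     (\<exists>D. smooth_distribution T \<iota> D \<and>
        (\<forall>x\<in>topspace T. nk_J (\<iota> x) ` D x = D x \<and>
           nk_J (\<iota> x) ` complement_in_tangent T \<iota> D x \<subseteq> normal T \<iota> x))"

definition almost_complex :: "'m topology \<Rightarrow> ('m \<Rightarrow> quat2) \<Rightarrow> bool" where
  "almost_complex T \<iota> \<longleftrightarrow> (\<forall>x\<in>topspace T. nk_J (\<iota> x) ` tangent T \<iota> x = tangent T \<iota> x)"

definition totally_real :: "'m topology \<Rightarrow> ('m \<Rightarrow> quat2) \<Rightarrow> bool" where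
  "totally_real T \<iota> \<longleftrightarrow> (\<forall>x\<in>topspace T. nk_J (\<iota> x) ` tangent T \<iota> x \<subseteq> normal T \<iota> x)"

definition proper_CR_submanifold :: "'m topology \<Rightarrow> ('m \<Rightarrow> quat2) \<Rightarrow> bool" where
  "proper_CR_submanifold T \<iota> \<longleftrightarrow>
     CR_submanifold T \<iota> \<and> \<not> almost_complex T \<iota> \<and> \<not> totally_real T \<iota>"

definition D1 :: "'m topology \<Rightarrow> ('m \<Rightarrow> quat2) \<Rightarrow> 'm \<Rightarrow> quat2 set" where
  "D1 T \<iota> x = nk_J (\<iota> x) ` tangent T \<iota> x \<inter> tangent T \<iota> x"

definition D2 :: "'m topology \<Rightarrow> ('m \<Rightarrow> quat2) \<Rightarrow> 'm \<Rightarrow> quat2 set" where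
  "D2 T \<iota> x =
     {v + nk_J (\<iota> x) w | v w. v \<in> complement_in_tangent T \<iota> (D1 T \<iota>) x \<and>
                            w \<in> complement_in_tangent T \<iota> (D1 T \<iota>) x}"

text \<open>The tensor \<open>G\<close> is evaluated on tangent vectors by extending them to vector fields.\<close>

definition D3 :: "connection \<Rightarrow> 'm topology \<Rightarrow> ('m \<Rightarrow> quat2) \<Rightarrow> 'm \<Rightarrow> quat2 set" where
  "D3 nabla T \<iota> x =
     span {nk_G nabla X Y (\<iota> x) | X Y. X \<in> vector_fields \<and> Y \<in> vector_fields \<and>
                                      X (\<iota> x) \<in> D1 T \<iota> x \<and> Y (\<iota> x) \<in> D2 T \<iota> x}"

end

theory Submission
  imports Defs
begin

text \<open>
  In the left-invariant frame a tangent vector of the product at \<open>(p, q)\<close> is a pair of vectors of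
  \<open>\<real>\<^sup>3\<close>. A plane invariant under \<open>J\<close> and \<open>P\<close> is spanned by \<open>(c, 0)\<close> and \<open>(0, c)\<close>. Let \<open>X = (\<beta>, \<gamma>)\<close> span the
  complement of \<open>D1\<close> in the tangent space, so that \<open>\<beta>\<close> and \<open>\<gamma>\<close> are orthogonal to \<open>c\<close>. Since \<open>\<nabla>\<^sub>W J\<close> is skew
  and anticommutes with \<open>J\<close>, \<open>G (W, Y)\<close> is orthogonal to \<open>X\<close> and \<open>J X\<close> for all \<open>Y\<close> in \<open>D2\<close>; no formula for \<open>G\<close> is
  needed. So \<open>P X\<close> in \<open>D3\<close> is orthogonal to \<open>X\<close> and \<open>J X\<close>, which says that \<open>\<beta>\<close> and \<open>\<gamma>\<close> have equal length and
  enclose an angle of 60 degrees.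

  Let \<open>\<theta>\<close> and \<open>\<phi>\<close> be the pullbacks of the Maurer-Cartan forms of the two factors to the submanifold. The
  tangent spaces are described by \<open>\<theta> \<bullet> (2\<gamma> - \<beta>) = 0\<close>, \<open>\<phi> \<bullet> (\<gamma> - 2\<beta>) = 0\<close> and \<open>\<theta> \<bullet> \<beta> = \<phi> \<bullet> \<gamma>\<close>. Differentiating
  these with \<open>d\<theta> (v, w) = -2 \<theta> v \<times> \<theta> w\<close> (and likewise for \<open>\<phi>\<close>) and evaluating on the vectors \<open>v1, v2, v3\<close>
  mapped to \<open>(c, 0)\<close>, \<open>(0, c)\<close> and \<open>X\<close> gives \<open>(c \<times> \<beta>) \<bullet> \<gamma> = 0\<close>, against the angle of 60 degrees.
\<close>

section \<open>The left-invariant frame\<close>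

lemmas quat_simps = prod_eq_iff vec_eq_iff forall_3 cross3_def inner_vec_def sum_3 vector_def inner_prod_def
  qmult_def qcnj_def

lemma qmult_assoc: "(x \<odot> y) \<odot> z = x \<odot> (y \<odot> z)"
  by (auto simp: quat_simps algebra_simps)

lemma qcnj_qmult_self: "qcnj p \<odot> p = (inner p p, 0)" "p \<odot> qcnj p = (inner p p, 0)"
  by (auto simp: quat_simps algebra_simps)

lemma qmult_of_real: "(r, 0) \<odot> x = r *\<^sub>R x"
  by (auto simp: quat_simps algebra_simps)

lemma qmult_cancel:
  assumes "norm p = 1"
  shows "qcnj p \<odot> (p \<odot> x) = x" "p \<odot> (qcnj p \<odot> x) = x"
  using assms
  by (simp_all add: qmult_assoc [symmetric] qcnj_qmult_self qmult_of_real norm_eq_1)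

lemma inner_qmult_adjoint: "inner (p \<odot> x) y = inner x (qcnj p \<odot> y)"
  by (auto simp: quat_simps algebra_simps)

lemma inner_qmult:
  assumes "norm p = 1"
  shows "inner (p \<odot> x) (p \<odot> y) = inner x y"
  by (simp add: inner_qmult_adjoint qmult_cancel [OF assms])

lemma fst_qcnj_qmult: "fst (qcnj p \<odot> x) = inner p x"
  by (auto simp: qmult_def qcnj_def inner_prod_def)

lemma linear_qcnj: "linear qcnj"
  by (rule linearI) (auto simp: qcnj_def)

lemma bilinear_qmult: "bilinear (\<odot>)"
  unfolding bilinear_def
  by (intro conjI allI linearI) (auto simp: quat_simps algebra_simps)

lemma qmult_left_simps:
  "(x + y) \<odot> z = x \<odot> z + y \<odot> z" "(c *\<^sub>R x) \<odot> y = c *\<^sub>R (x \<odot> y)"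
  by (auto simp: quat_simps algebra_simps)

lemma qmult_right_simps:
  "x \<odot> (y + z) = x \<odot> y + x \<odot> z" "x \<odot> (y - z) = x \<odot> y - x \<odot> z" "x \<odot> (c *\<^sub>R y) = c *\<^sub>R (x \<odot> y)"
  by (auto simp: quat_simps algebra_simps)

section \<open>The structure tensors in left-invariant coordinates\<close>

type_synonym vec2 = "(real^3) \<times> (real^3)"

text \<open>Left translation identifies every tangent space with \<real>^3 \<times> \<real>^3. In
  these coordinates J, P and g have constant coefficients, so pointwise questions become linear
  algebra.\<close>

definition frame :: "quat2 \<Rightarrow> vec2 \<Rightarrow> quat2" where
  "frame z A = (fst z \<odot> (0, fst A), snd z \<odot> (0, snd A))"

text \<open>The Maurer-Cartan forms of the two factors. The discarded real parts vanish on tangent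
  vectors. The formula is real bilinear in the base point and the vector, which makes it easy to
  differentiate along a map.\<close>

definition coframe :: "quat2 \<Rightarrow> quat2 \<Rightarrow> vec2" where
  "coframe z Z = (snd (qcnj (fst z) \<odot> fst Z), snd (qcnj (snd z) \<odot> snd Z))"

definition J0 :: "vec2 \<Rightarrow> vec2" where
  "J0 A = (1 / sqrt 3) *\<^sub>R (2 *\<^sub>R snd A - fst A, snd A - 2 *\<^sub>R fst A)"

text \<open>The average of the Euclidean product and its pullback under \<open>J0\<close>,
  multiplied out.\<close>

definition g0 :: "vec2 \<Rightarrow> vec2 \<Rightarrow> real" where
  "g0 A B = 4/3 * inner A B - 2/3 * (inner (fst A) (snd B) + inner (snd A) (fst B))"

lemma norm_S3S3: "z \<in> S3S3 \<Longrightarrow> norm (fst z) = 1" "z \<in> S3S3 \<Longrightarrow> norm (snd z) = 1"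
  by (auto simp: S3S3_def)

lemma linear_frame: "linear (frame z)"
  by (rule linearI) (auto simp: frame_def quat_simps algebra_simps)

lemma linear_coframe: "linear (coframe z)"
  by (rule linearI) (auto simp: coframe_def quat_simps algebra_simps)

lemma linear_J0: "linear J0"
  by (rule linearI) (auto simp: J0_def algebra_simps)

lemma coframe_frame: "z \<in> S3S3 \<Longrightarrow> coframe z (frame z A) = A"
  by (simp add: coframe_def frame_def qmult_cancel norm_S3S3)

lemma inj_frame: "z \<in> S3S3 \<Longrightarrow> inj (frame z)"
  by (metis coframe_frame injI)

lemma tangent_S3S3_eq_frame: "tangent_S3S3 z = range (frame z)"
  by (force simp: tangent_S3S3_def frame_def Im_quat_def image_iff)

lemma frame_coframe: "z \<in> S3S3 \<Longrightarrow> Z \<in> tangent_S3S3 z \<Longrightarrow> frame z (coframe z Z) = Z"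
  by (auto simp: tangent_S3S3_eq_frame coframe_frame)

text \<open>For a unit quaternion p, the real part of \<open>qcnj p \<odot> x\<close> is the inner
  product of p and x, so this product is purely imaginary exactly when x is orthogonal to p.\<close>

lemma tangent_S3S3_iff:
  assumes "z \<in> S3S3"
  shows "Z \<in> tangent_S3S3 z \<longleftrightarrow> inner (fst z) (fst Z) = 0 \<and> inner (snd z) (snd Z) = 0"
proof
  assume "Z \<in> tangent_S3S3 z"
  then obtain a b where Z: "Z = (fst z \<odot> (0, a), snd z \<odot> (0, b))"
    by (auto simp: tangent_S3S3_eq_frame frame_def)
  have "inner (p \<odot> (0, x)) p = 0" for p x
    unfolding inner_qmult_adjoint qcnj_qmult_self by simp
  with Z show "inner (fst z) (fst Z) = 0 \<and> inner (snd z) (snd Z) = 0"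
    by (simp add: inner_commute)
next
  assume "inner (fst z) (fst Z) = 0 \<and> inner (snd z) (snd Z) = 0"
  then have "(0, snd (qcnj (fst z) \<odot> fst Z)) = qcnj (fst z) \<odot> fst Z"
    "(0, snd (qcnj (snd z) \<odot> snd Z)) = qcnj (snd z) \<odot> snd Z"
    by (simp_all add: prod_eq_iff fst_qcnj_qmult)
  then have "frame z (coframe z Z) = Z"
    using assms by (simp add: frame_def coframe_def qmult_cancel norm_S3S3)
  then show "Z \<in> tangent_S3S3 z"
    by (metis rangeI tangent_S3S3_eq_frame)
qed

lemma nk_J_frame: "z \<in> S3S3 \<Longrightarrow> nk_J z (frame z A) = frame z (J0 A)"
  unfolding nk_J_def frame_def J0_def Let_def fst_conv snd_conv
  by (simp add: qmult_cancel norm_S3S3 flip: bilinear_rmul [OF bilinear_qmult])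

lemma nk_P_frame: "z \<in> S3S3 \<Longrightarrow> nk_P z (frame z A) = frame z (prod.swap A)"
  by (simp add: nk_P_def frame_def qmult_cancel norm_S3S3 Let_def)

lemma nk_g_frame:
  assumes "z \<in> S3S3"
  shows "nk_g z (frame z A) (frame z B) = g0 A B"
proof -
  have *: "inner (frame z A) (frame z B) = inner A B" for A B
    using assms by (simp add: frame_def inner_qmult norm_S3S3 inner_prod_def[of A B])
  show ?thesis
    unfolding nk_g_def nk_J_frame [OF assms] *
    by (simp add: g0_def J0_def inner_prod_def inner_diff_left inner_diff_right field_simps inner_commute)
qed

lemma J0_J0: "J0 (J0 A) = - A"
  by (simp add: J0_def prod_eq_iff vec_eq_iff field_simps)

lemma g0_sym: "g0 A B = g0 B A"
  by (simp add: g0_def inner_commute)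

lemma g0_J0_J0: "g0 (J0 A) (J0 B) = g0 A B"
  by (simp add: g0_def J0_def inner_prod_def algebra_simps inner_commute)

lemma g0_J0: "g0 (J0 A) B = - g0 A (J0 B)"
  by (simp add: g0_def J0_def inner_prod_def algebra_simps inner_commute)

lemma bilinear_g0: "bilinear g0"
  unfolding bilinear_def
  by (intro conjI allI linearI) (auto simp: g0_def algebra_simps)

lemma g0_pos: "A \<noteq> 0 \<Longrightarrow> g0 A A > 0"
proof -
  assume "A \<noteq> 0"
  have "g0 A A = 2/3 * inner A A + 2/3 * inner (fst A - snd A) (fst A - snd A)"
    by (simp add: g0_def inner_prod_def algebra_simps inner_commute)
  moreover have "inner A A > 0" using \<open>A \<noteq> 0\<close> by simp
  ultimately show ?thesis by (metis add_pos_nonneg inner_ge_zero mult_pos_pos mult_nonneg_nonneg zero_less_divide_iff zero_less_numeral less_imp_le)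
qed

section \<open>Vector fields on the product of spheres\<close>

lemma Ck_on_Suc_imp: "Ck_on (Suc k) f U \<Longrightarrow> Ck_on k f U"
proof (induction k arbitrary: f)
  case 0
  then show ?case
    by (simp add: differentiable_imp_continuous_on differentiable_on_def differentiable_at_withinI)
next
  case (Suc k)
  from Suc.prems have d: "\<forall>x\<in>U. f differentiable at x"
    and c: "\<And>v. Ck_on (Suc k) (\<lambda>x. frechet_derivative f (at x) v) U"
    by (simp, simp only: Ck_on.simps(2), blast)
  from d Suc.IH [OF c] show ?case
    by simp
qed

lemma Ck_on_const: "Ck_on k (\<lambda>_. c) U"
  by (induction k arbitrary: c) (auto simp: frechet_derivative_const)

lemma Ck_on_add:
  assumes "Ck_on k f UNIV" "Ck_on k g UNIV"
  shows "Ck_on k (\<lambda>x. f x + g x) UNIV"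
  using assms
proof (induction k arbitrary: f g)
  case 0
  then show ?case by (auto intro: continuous_on_add)
next
  case (Suc k)
  then have d: "f differentiable at x" "g differentiable at x" for x
    by auto
  have "Ck_on k (\<lambda>x. frechet_derivative f (at x) v + frechet_derivative g (at x) v) UNIV" for v
    using Suc by auto
  moreover have "frechet_derivative (\<lambda>x. f x + g x) (at x) =
      (\<lambda>v. frechet_derivative f (at x) v + frechet_derivative g (at x) v)" for x
    using d by (intro frechet_derivative_at [symmetric] has_derivative_add)
      (auto simp: frechet_derivative_works)
  ultimately show ?case
    using d by (auto intro: differentiable_add)
qed

lemma Ck_on_bounded_linear:
  assumes "bounded_linear L" "Ck_on k f UNIV"
  shows "Ck_on k (\<lambda>x. L (f x)) UNIV"
  using assms(2)
proof (induction k arbitrary: f)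
  case 0
  then show ?case
    using assms(1) by (auto intro: bounded_linear.continuous_on)
next
  case (Suc k)
  then have d: "(f has_derivative frechet_derivative f (at x)) (at x)" for x
    by (auto simp: frechet_derivative_works)
  from bounded_linear.has_derivative [OF assms(1) d]
  have d': "((\<lambda>x. L (f x)) has_derivative (\<lambda>v. L (frechet_derivative f (at x) v))) (at x)" for x .
  have "Ck_on k (\<lambda>x. L (frechet_derivative f (at x) v)) UNIV" for v
    using Suc by auto
  with d' show ?case
    by (auto simp: frechet_derivative_at [OF d', symmetric] intro: differentiableI)
qed

text \<open>The product rule writes the derivative as a sum of two products of the same kind, each
  pairing one of the functions with a derivative of the other. The induction step therefore also
  needs the functions themselves one order lower, which \<open>Ck_on_Suc_imp\<close>
  provides.\<close>

lemma Ck_on_bounded_bilinear: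
  assumes "bounded_bilinear B" "Ck_on k f UNIV" "Ck_on k g UNIV"
  shows "Ck_on k (\<lambda>x. B (f x) (g x)) UNIV"
  using assms(2,3)
proof (induction k arbitrary: f g)
  case 0
  then show ?case
    using assms(1) by (auto intro: bounded_bilinear.continuous_on)
next
  case (Suc k)
  then have d: "(f has_derivative frechet_derivative f (at x)) (at x)"
    "(g has_derivative frechet_derivative g (at x)) (at x)" for x
    by (auto simp: frechet_derivative_works)
  from bounded_bilinear.FDERIV [OF assms(1) d]
  have d': "((\<lambda>x. B (f x) (g x)) has_derivative
      (\<lambda>v. B (f x) (frechet_derivative g (at x) v) + B (frechet_derivative f (at x) v) (g x))) (at x)" for x .
  have "Ck_on k f UNIV" "Ck_on k g UNIV"
    using Suc.prems Ck_on_Suc_imp by blast+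
  then have "Ck_on k (\<lambda>x. B (f x) (frechet_derivative g (at x) v) + B (frechet_derivative f (at x) v) (g x)) UNIV" for v
    using Suc by (intro Ck_on_add Suc.IH) auto
  with d' show ?case
    by (auto simp: frechet_derivative_at [OF d', symmetric] intro: differentiableI)
qed

lemma smooth_on_bounded_linear:
  "bounded_linear L \<Longrightarrow> smooth_on f UNIV \<Longrightarrow> smooth_on (\<lambda>x. L (f x)) UNIV"
  by (simp add: smooth_on_def Ck_on_bounded_linear)

lemma smooth_on_linear: "bounded_linear L \<Longrightarrow> smooth_on L UNIV"
proof -
  have *: "bounded_linear L \<Longrightarrow> Ck_on k L UNIV" for k
    by (cases k) (auto simp: bounded_linear_imp_differentiable frechet_derivative_at [OF bounded_linear_imp_has_derivative, symmetric]
        Ck_on_const intro: linear_continuous_on)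
  show "bounded_linear L \<Longrightarrow> ?thesis"
    by (simp add: smooth_on_def *)
qed

lemma smooth_on_bounded_bilinear:
  "bounded_bilinear B \<Longrightarrow> smooth_on f UNIV \<Longrightarrow> smooth_on g UNIV \<Longrightarrow> smooth_on (\<lambda>x. B (f x) (g x)) UNIV"
  by (simp add: smooth_on_def Ck_on_bounded_bilinear)

lemma smooth_on_add:
  "smooth_on f UNIV \<Longrightarrow> smooth_on g UNIV \<Longrightarrow> smooth_on (\<lambda>x. f x + g x) UNIV"
  by (simp add: smooth_on_def Ck_on_add)

lemma smooth_on_Pair:
  assumes "smooth_on f UNIV" "smooth_on g UNIV"
  shows "smooth_on (\<lambda>x. (f x, g x)) UNIV"
proof -
  have "bounded_linear (\<lambda>a. (a, 0))" "bounded_linear (\<lambda>b. (0, b))"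
    by (auto intro!: bounded_linear_intros)
  with smooth_on_add [OF smooth_on_bounded_linear smooth_on_bounded_linear] assms
  show ?thesis by fastforce
qed

lemma smooth_on_imp_differentiable: "smooth_on f U \<Longrightarrow> x \<in> U \<Longrightarrow> f differentiable at x"
  unfolding smooth_on_def by (metis Ck_on.simps(2))

lemma bounded_bilinear_qmult: "bounded_bilinear (\<odot>)"
  using bilinear_qmult bilinear_conv_bounded_bilinear by blast

section \<open>Smooth vector fields, and J and g along them\<close>

lemma smooth_on_nk_J:
  assumes "smooth_on Y UNIV"
  shows "smooth_on (\<lambda>w. nk_J w (Y w)) UNIV"
proof -
  note s = smooth_on_bounded_bilinear [OF bounded_bilinear_qmult]
    smooth_on_bounded_linear [OF bounded_linear_fst assms]
    smooth_on_bounded_linear [OF bounded_linear_snd assms]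
    smooth_on_linear [OF bounded_linear_fst] smooth_on_linear [OF bounded_linear_snd]
    smooth_on_bounded_linear [OF linear_conv_bounded_linear [THEN iffD1, OF linear_qcnj]]
    smooth_on_Pair smooth_on_add
    smooth_on_bounded_linear [OF bounded_linear_scaleR_right]
  \<comment> \<open>Differences become sums with negative scalars, so that the closure rules for
    sums, products, pairs and linear maps cover the whole expression.\<close>
  have eq: "nk_J w (Y w) = (1 / sqrt 3) *\<^sub>R
       (fst w \<odot> (2 *\<^sub>R (qcnj (snd w) \<odot> snd (Y w)) + (-1) *\<^sub>R (qcnj (fst w) \<odot> fst (Y w))),
        snd w \<odot> ((-2) *\<^sub>R (qcnj (fst w) \<odot> fst (Y w)) + qcnj (snd w) \<odot> snd (Y w)))" for w
    by (simp add: nk_J_def Let_def)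
  show ?thesis
    unfolding eq by (intro s)
qed

lemma nk_J_tangent: "z \<in> S3S3 \<Longrightarrow> Z \<in> tangent_S3S3 z \<Longrightarrow> nk_J z Z \<in> tangent_S3S3 z"
  by (auto simp: tangent_S3S3_eq_frame nk_J_frame)

lemma nk_J_vector_field: "Y \<in> vector_fields \<Longrightarrow> (\<lambda>w. nk_J w (Y w)) \<in> vector_fields"
  by (simp add: vector_fields_def smooth_on_nk_J nk_J_tangent)

text \<open>A left-invariant field depends linearly on the base point, so the same formula extends
  it smoothly to the ambient space.\<close>

lemma frame_vector_field: "(\<lambda>w. frame w A) \<in> vector_fields"
proof -
  have "linear (\<lambda>w. frame w A)"
    by (rule linearI) (simp_all add: frame_def qmult_left_simps)
  then have "smooth_on (\<lambda>w. frame w A) UNIV"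
    by (intro smooth_on_linear) (simp add: linear_conv_bounded_linear)
  then show ?thesis
    by (simp add: vector_fields_def tangent_S3S3_eq_frame)
qed

lemma nk_g_differentiable:
  assumes "X \<in> vector_fields" "Y \<in> vector_fields"
  shows "(\<lambda>w. nk_g w (X w) (Y w)) differentiable at z"
proof -
  have "smooth_on X UNIV" "smooth_on Y UNIV"
    using assms by (auto simp: vector_fields_def)
  with smooth_on_nk_J have "X differentiable at z" "Y differentiable at z"
    "(\<lambda>w. nk_J w (X w)) differentiable at z" "(\<lambda>w. nk_J w (Y w)) differentiable at z"
    using smooth_on_imp_differentiable by blast+
  then show ?thesis
    unfolding nk_g_def
    by (intro differentiable_mult differentiable_const differentiable_add differentiable_inner)
qed

text \<open>Vector fields are extended off \<open>S3S3\<close>, where \<open>J\<close> is no longer a complex structure; identities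
  such as \<open>g (J X, J Y) = g (X, Y)\<close> may therefore only be differentiated in tangential directions.\<close>

lemma frechet_derivative_zero_on_S3S3:
  fixes h :: "quat2 \<Rightarrow> real"
  assumes h: "h differentiable at z" and h0: "\<And>w. w \<in> S3S3 \<Longrightarrow> h w = 0"
    and z: "z \<in> S3S3" and v: "v \<in> tangent_S3S3 z"
  shows "frechet_derivative h (at z) v = 0"
proof -
  \<comment> \<open>A curve through z with velocity v: each component of z + t v is normalised.
    Tangency of v makes the squared norms 1 + t^2 |v_i|^2, so the curve stays on \<open>S3S3\<close>
    and the normalising factors have derivative 0 at t = 0.\<close>
  define c :: "real \<Rightarrow> quat2" where
    "c t = (inverse (sqrt (1 + t\<^sup>2 * (norm (fst v))\<^sup>2)) *\<^sub>R (fst z + t *\<^sub>R fst v),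
            inverse (sqrt (1 + t\<^sup>2 * (norm (snd v))\<^sup>2)) *\<^sub>R (snd z + t *\<^sub>R snd v))" for t
  have n: "norm (inverse (sqrt (1 + t\<^sup>2 * (norm b)\<^sup>2)) *\<^sub>R (a + t *\<^sub>R b)) = 1"
    if "norm a = 1" "inner a b = 0" for a b :: quat and t :: real
  proof -
    have "(norm (a + t *\<^sub>R b))\<^sup>2 = 1 + t\<^sup>2 * (norm b)\<^sup>2"
      using that unfolding power2_norm_eq_inner norm_eq_1 inner_left_distrib inner_right_distrib
      by (simp add: inner_commute [of b a] power2_eq_square)
    moreover have "0 < 1 + t\<^sup>2 * (norm b)\<^sup>2"
      by (simp add: add_pos_nonneg)
    ultimately have "sqrt (1 + t\<^sup>2 * (norm b)\<^sup>2) = norm (a + t *\<^sub>R b)" "norm (a + t *\<^sub>R b) \<noteq> 0"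
      by (metis norm_ge_zero real_sqrt_unique, metis less_irrefl power_zero_numeral)
    then show ?thesis by simp
  qed
  have "inner (fst z) (fst v) = 0" "inner (snd z) (snd v) = 0"
    using v tangent_S3S3_iff [OF z] by auto
  then have c_in: "c t \<in> S3S3" for t
    using n norm_S3S3 [OF z] by (simp add: S3S3_def c_def)
  have c0: "c 0 = z"
    by (simp add: c_def)
  have "(c has_derivative (\<lambda>t. t *\<^sub>R v)) (at 0)"
    unfolding c_def by (auto intro!: derivative_eq_intros simp: prod_eq_iff)
  moreover have "(h has_derivative frechet_derivative h (at z)) (at (c 0))"
    using h by (simp add: c0 frechet_derivative_works)
  ultimately have "((\<lambda>t. h (c t)) has_derivative (\<lambda>t. frechet_derivative h (at z) (t *\<^sub>R v))) (at 0)"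
    using has_derivative_compose by blast
  moreover have "(\<lambda>t. h (c t)) = (\<lambda>t. 0)"
    using h0 c_in by auto
  ultimately have "(\<lambda>t. frechet_derivative h (at z) (t *\<^sub>R v)) = (\<lambda>t. 0)"
    by (metis has_derivative_const has_derivative_unique)
  from fun_cong [OF this, of 1] show ?thesis by simp
qed

lemma vector_field_tangent: "X \<in> vector_fields \<Longrightarrow> z \<in> S3S3 \<Longrightarrow> X z \<in> tangent_S3S3 z"
  by (simp add: vector_fields_def)

lemma nk_g_sym: "nk_g z Z W = nk_g z W Z"
  by (simp add: nk_g_def inner_commute)

lemma linear_nk_J: "linear (nk_J z)"
  by (rule linearI) (auto simp: nk_J_def Let_def qmult_right_simps algebra_simps)

lemma nk_g_simps:
  "nk_g z (Z + W) V = nk_g z Z V + nk_g z W V" "nk_g z (Z - W) V = nk_g z Z V - nk_g z W V"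
  "nk_g z (c *\<^sub>R Z) V = c * nk_g z Z V" "nk_g z (- Z) V = - nk_g z Z V"
  "nk_g z V (Z + W) = nk_g z V Z + nk_g z V W" "nk_g z V (Z - W) = nk_g z V Z - nk_g z V W"
  "nk_g z V (c *\<^sub>R Z) = c * nk_g z V Z" "nk_g z V (- Z) = - nk_g z V Z"
  by (simp_all add: nk_g_def linear_add [OF linear_nk_J] linear_diff [OF linear_nk_J]
      linear_scale [OF linear_nk_J] linear_neg [OF linear_nk_J] algebra_simps)

lemma nk_g_J:
  assumes "z \<in> S3S3" "Z \<in> tangent_S3S3 z" "W \<in> tangent_S3S3 z"
  shows "nk_g z (nk_J z Z) W = - nk_g z Z (nk_J z W)"
    and "nk_g z (nk_J z Z) (nk_J z W) = nk_g z Z W"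
  using assms by (auto simp: tangent_S3S3_eq_frame nk_J_frame nk_g_frame g0_J0)
    (metis g0_J0 g0_J0_J0)

section \<open>The covariant derivative of J for a Levi-Civita connection\<close>

locale nk_connection =
  fixes nabla :: connection
  assumes levi_civita: "levi_civita nabla"
begin

lemma nabla_vector_field: "X \<in> vector_fields \<Longrightarrow> Y \<in> vector_fields \<Longrightarrow> nabla X Y \<in> vector_fields"
  using levi_civita by (simp add: levi_civita_def affine_connection_def)

lemma nabla_metric:
  assumes "X \<in> vector_fields" "Y \<in> vector_fields" "Z \<in> vector_fields" "z \<in> S3S3"
  shows "((\<lambda>w. nk_g w (Y w) (Z w)) has_derivative
      frechet_derivative (\<lambda>w. nk_g w (Y w) (Z w)) (at z)) (at z)"
    and "frechet_derivative (\<lambda>w. nk_g w (Y w) (Z w)) (at z) (X z) =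
      nk_g z (nabla X Y z) (Z z) + nk_g z (Y z) (nabla X Z z)"
  using assms levi_civita nk_g_differentiable
  by (simp_all add: levi_civita_def metric_connection_def flip: frechet_derivative_works)

text \<open>The function g(JY, Z) + g(Y, JZ) vanishes on \<open>S3S3\<close>. Its derivative along
  X, expanded by metric compatibility and with J moved across g, is g(G(X,Y), Z) + g(Y,
  G(X,Z)).\<close>

lemma nk_G_skew:
  assumes "X \<in> vector_fields" "Y \<in> vector_fields" "Z \<in> vector_fields" "z \<in> S3S3"
  shows "nk_g z (nk_G nabla X Y z) (Z z) = - nk_g z (Y z) (nk_G nabla X Z z)"
proof -
  let ?JY = "\<lambda>w. nk_J w (Y w)" and ?JZ = "\<lambda>w. nk_J w (Z w)"
  let ?h = "\<lambda>w. nk_g w (?JY w) (Z w) + nk_g w (Y w) (?JZ w)"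
  note vf = assms(1-3) nk_J_vector_field [OF assms(2)] nk_J_vector_field [OF assms(3)]
  note d = has_derivative_add [OF nabla_metric(1) nabla_metric(1), OF vf(1,4,3) assms(4) vf(1,2,5) assms(4)]
  have "?h w = 0" if "w \<in> S3S3" for w
    using nk_g_J(1) [OF that] vf that by (simp add: vector_field_tangent)
  with d have "frechet_derivative ?h (at z) (X z) = 0"
    by (intro frechet_derivative_zero_on_S3S3)
      (use assms in \<open>auto simp: vector_field_tangent intro: differentiableI\<close>)
  then have "nk_g z (nabla X ?JY z) (Z z) + nk_g z (?JY z) (nabla X Z z)
      + (nk_g z (nabla X Y z) (?JZ z) + nk_g z (Y z) (nabla X ?JZ z)) = 0"
    by (simp add: frechet_derivative_at [OF d, symmetric] nabla_metric(2) [OF vf(1,4,3) assms(4)]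
        nabla_metric(2) [OF vf(1,2,5) assms(4)])
  then show ?thesis
    using vf assms(4) nk_g_J(1) [of z "nabla X Y z" "Z z"] nk_g_J(1) [of z "Y z" "nabla X Z z"]
    by (simp add: nk_G_def nk_g_simps
        vector_field_tangent nabla_vector_field)
qed

text \<open>The first equation is skewness on the diagonal. For the second, differentiating g(JZ,
  JZ) = g(Z, Z) along X gives g(\<nabla>(JZ), JZ) = g(\<nabla>Z, Z), and the right side equals g(J
  \<nabla>Z, JZ).\<close>

lemma nk_G_orthogonal:
  assumes "X \<in> vector_fields" "Z \<in> vector_fields" "z \<in> S3S3"
  shows "nk_g z (nk_G nabla X Z z) (Z z) = 0"
    and "nk_g z (nk_G nabla X Z z) (nk_J z (Z z)) = 0"
proof -
  show "nk_g z (nk_G nabla X Z z) (Z z) = 0"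
    using nk_G_skew [of X Z Z z] assms nk_g_sym [of z "Z z"] by simp
  let ?JZ = "\<lambda>w. nk_J w (Z w)"
  let ?h = "\<lambda>w. nk_g w (?JZ w) (?JZ w) - nk_g w (Z w) (Z w)"
  note vf = assms(1,2) nk_J_vector_field [OF assms(2)]
  note d = has_derivative_diff [OF nabla_metric(1) nabla_metric(1), OF vf(1,3,3) assms(3) vf(1,2,2) assms(3)]
  have "?h w = 0" if "w \<in> S3S3" for w
    using nk_g_J(2) [OF that] vf that by (simp add: vector_field_tangent)
  with d have "frechet_derivative ?h (at z) (X z) = 0"
    by (intro frechet_derivative_zero_on_S3S3)
      (use assms in \<open>auto simp: vector_field_tangent intro: differentiableI\<close>)
  then have "nk_g z (nabla X ?JZ z) (?JZ z) = nk_g z (nabla X Z z) (Z z)"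
    by (simp add: frechet_derivative_at [OF d, symmetric] nabla_metric(2) [OF vf(1,3,3) assms(3)]
        nabla_metric(2) [OF vf(1,2,2) assms(3)]
        nk_g_sym [of z "?JZ z"] nk_g_sym [of z "Z z"])
  then show "nk_g z (nk_G nabla X Z z) (nk_J z (Z z)) = 0"
    using vf assms(3) nk_g_J(2) [of z "nabla X Z z" "Z z"]
    by (simp add: nk_G_def nk_g_simps vector_field_tangent nabla_vector_field)
qed

text \<open>Skewness moves the derivative from Y to the left-invariant fields with coordinates A and
  \<open>J0 A\<close>, so only the value \<open>Y z\<close> enters. That value is a combination of
  the two vectors to which \<open>nk_G_orthogonal\<close> applies.\<close>

lemma nk_G_orthogonal_line:
  assumes "X \<in> vector_fields" "Y \<in> vector_fields" "z \<in> S3S3"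
    and Y: "Y z = a *\<^sub>R frame z A + b *\<^sub>R nk_J z (frame z A)"
  shows "nk_g z (nk_G nabla X Y z) (frame z A) = 0"
    and "nk_g z (nk_G nabla X Y z) (nk_J z (frame z A)) = 0"
proof -
  let ?A = "\<lambda>w. frame w A" and ?JA = "\<lambda>w. frame w (J0 A)"
  have J: "nk_J z (frame z A) = frame z (J0 A)" "nk_J z (frame z (J0 A)) = - frame z A"
    using assms(3) by (simp_all add: nk_J_frame J0_J0 linear_neg [OF linear_frame])
  note G = nk_G_orthogonal [OF assms(1) frame_vector_field assms(3)]
  show "nk_g z (nk_G nabla X Y z) (frame z A) = 0"
    using nk_G_skew [OF assms(1,2) frame_vector_field assms(3), of A] G [of A]
    unfolding Y by (simp add: nk_g_simps nk_g_sym)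
  show "nk_g z (nk_G nabla X Y z) (nk_J z (frame z A)) = 0"
    using nk_G_skew [OF assms(1,2) frame_vector_field assms(3), of "J0 A"] G [of "J0 A"]
    unfolding Y by (simp add: nk_g_simps nk_g_sym J)
qed

end

section \<open>Symmetry of second derivatives\<close>

text \<open>Two applications of the mean value theorem: along v to the increment of F in direction
  w, then along w to the derivative of F in direction v.\<close>

lemma second_difference_mvt:
  fixes F :: "'a::euclidean_space \<Rightarrow> real"
  assumes t: "t > 0"
    and U: "\<And>s r. 0 \<le> s \<Longrightarrow> s \<le> t \<Longrightarrow> 0 \<le> r \<Longrightarrow> r \<le> t \<Longrightarrow> x + s *\<^sub>R v + r *\<^sub>R w \<in> U"
    and F: "\<And>y. y \<in> U \<Longrightarrow> (F has_derivative F' y) (at y)"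
    and A: "\<And>y. y \<in> U \<Longrightarrow> ((\<lambda>y. F' y v) has_derivative A y) (at y)"
  obtains s r where "0 \<le> s" "s \<le> t" "0 \<le> r" "r \<le> t"
    "F (x + t *\<^sub>R v + t *\<^sub>R w) - F (x + t *\<^sub>R v) - F (x + t *\<^sub>R w) + F x
      = t\<^sup>2 * A (x + s *\<^sub>R v + r *\<^sub>R w) w"
proof -
  \<comment> \<open>The summand \<open>0 *\<^sub>R w\<close> gives both terms the same shape, so
    that one derivative formula with parameter r covers r = t and r = 0.\<close>
  define h where "h s = F (x + s *\<^sub>R v + t *\<^sub>R w) - F (x + s *\<^sub>R v + 0 *\<^sub>R w)" for s
  have "(h has_real_derivative (F' (x + s *\<^sub>R v + t *\<^sub>R w) v - F' (x + s *\<^sub>R v + 0 *\<^sub>R w) v)) (at s)"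
    if "0 \<le> s" "s \<le> t" for s
  proof -
    have *: "((\<lambda>s. F (x + s *\<^sub>R v + r *\<^sub>R w)) has_derivative
        (\<lambda>d. F' (x + s *\<^sub>R v + r *\<^sub>R w) (d *\<^sub>R v))) (at s)" if "0 \<le> r" "r \<le> t" for r
      by (rule has_derivative_compose [where f = "\<lambda>s. x + s *\<^sub>R v + r *\<^sub>R w" and g = F, OF _ F [OF U]])
        (use that \<open>0 \<le> s\<close> \<open>s \<le> t\<close> in \<open>auto intro!: derivative_eq_intros\<close>)
    have "(h has_derivative
        (\<lambda>d. F' (x + s *\<^sub>R v + t *\<^sub>R w) (d *\<^sub>R v) - F' (x + s *\<^sub>R v + 0 *\<^sub>R w) (d *\<^sub>R v))) (at s)"
      unfolding h_def using * [of t] * [of 0] t by (intro has_derivative_diff) auto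
    moreover
    have "linear (F' (x + s *\<^sub>R v + t *\<^sub>R w))" "linear (F' (x + s *\<^sub>R v + 0 *\<^sub>R w))"
      using F [OF U, THEN has_derivative_linear, of s t] F [OF U, THEN has_derivative_linear, of s 0]
        that t by simp_all
    then have "F' (x + s *\<^sub>R v + t *\<^sub>R w) (d *\<^sub>R v) - F' (x + s *\<^sub>R v + 0 *\<^sub>R w) (d *\<^sub>R v)
        = (F' (x + s *\<^sub>R v + t *\<^sub>R w) v - F' (x + s *\<^sub>R v + 0 *\<^sub>R w) v) * d" for d
      by (simp only: linear_scale real_scaleR_def algebra_simps)
    ultimately show ?thesis
      unfolding has_field_derivative_def by simp
  qed
  from MVT2 [OF t this] obtain s where s: "0 < s" "s < t"
    "h t - h 0 = (t - 0) * (F' (x + s *\<^sub>R v + t *\<^sub>R w) v - F' (x + s *\<^sub>R v + 0 *\<^sub>R w) v)"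
    by blast
  have "((\<lambda>r. F' (x + s *\<^sub>R v + r *\<^sub>R w) v) has_real_derivative A (x + s *\<^sub>R v + r *\<^sub>R w) w) (at r)"
    if "0 \<le> r" "r \<le> t" for r
  proof -
    have "((\<lambda>r. F' (x + s *\<^sub>R v + r *\<^sub>R w) v) has_derivative
        (\<lambda>d. A (x + s *\<^sub>R v + r *\<^sub>R w) (d *\<^sub>R w))) (at r)"
      by (rule has_derivative_compose [where f = "\<lambda>r. x + s *\<^sub>R v + r *\<^sub>R w" and g = "\<lambda>y. F' y v", OF _ A [OF U]])
        (use that s in \<open>auto intro!: derivative_eq_intros\<close>)
    moreover have "linear (A (x + s *\<^sub>R v + r *\<^sub>R w))"
      using A [OF U, THEN has_derivative_linear] that s by auto
    ultimately show ?thesis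
      by (simp add: has_field_derivative_def linear_scale mult_commute_abs)
  qed
  from MVT2 [OF t this] obtain r where r: "0 < r" "r < t"
    "F' (x + s *\<^sub>R v + t *\<^sub>R w) v - F' (x + s *\<^sub>R v + 0 *\<^sub>R w) v
      = (t - 0) * A (x + s *\<^sub>R v + r *\<^sub>R w) w"
    by blast
  have "F (x + t *\<^sub>R v + t *\<^sub>R w) - F (x + t *\<^sub>R v) - F (x + t *\<^sub>R w) + F x = h t - h 0"
    by (simp add: h_def)
  also have "\<dots> = t\<^sup>2 * A (x + s *\<^sub>R v + r *\<^sub>R w) w"
    using s r by (simp add: power2_eq_square)
  finally show ?thesis
    using that [of s r] s r by simp
qed

text \<open>The second difference is symmetric in v and w. Computed in either order it is t^2 times
  a mixed second derivative at some point near x, and continuity at x identifies the two values as t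
  shrinks.\<close>

lemma second_derivative_symmetric_real:
  fixes F :: "'a::euclidean_space \<Rightarrow> real"
  assumes "open U" "x \<in> U"
    and F: "\<And>y. y \<in> U \<Longrightarrow> (F has_derivative F' y) (at y)"
    and A: "\<And>y. y \<in> U \<Longrightarrow> ((\<lambda>y. F' y v) has_derivative A y) (at y)"
    and B: "\<And>y. y \<in> U \<Longrightarrow> ((\<lambda>y. F' y w) has_derivative B y) (at y)"
    and cA: "continuous (at x) (\<lambda>y. A y w)" and cB: "continuous (at x) (\<lambda>y. B y v)"
  shows "A x w = B x v"
proof (rule ccontr)
  assume ne: "A x w \<noteq> B x v"
  \<comment> \<open>Half the supposed gap: two equal numbers cannot lie strictly within this
    distance of \<open>A x w\<close> and of \<open>B x v\<close>.\<close>
  define e where "e = \<bar>A x w - B x v\<bar> / 2"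
  have "e > 0" using ne by (simp add: e_def)
  obtain dA where dA: "dA > 0" "\<And>y. dist y x < dA \<Longrightarrow> \<bar>A y w - A x w\<bar> < e"
    using cA \<open>e > 0\<close> unfolding continuous_at_eps_delta dist_real_def by blast
  obtain dB where dB: "dB > 0" "\<And>y. dist y x < dB \<Longrightarrow> \<bar>B y v - B x v\<bar> < e"
    using cB \<open>e > 0\<close> unfolding continuous_at_eps_delta dist_real_def by blast
  obtain dU where dU: "dU > 0" "\<And>y. dist y x < dU \<Longrightarrow> y \<in> U"
    using assms(1,2) unfolding open_dist by blast
  define d where "d = min dA (min dB dU)"
  \<comment> \<open>Small enough that the whole parallelogram with sides t v and t w lies in the
    ball of radius d. The added 1 avoids division by zero.\<close>
  define t where "t = d / (2 * (norm v + norm w + 1))"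
  have "d > 0" using dA dB dU by (simp add: d_def)
  then have t: "t > 0"
    by (simp add: t_def add_nonneg_pos)
  have near: "dist (x + s *\<^sub>R v + r *\<^sub>R w) x < d" if "0 \<le> s" "s \<le> t" "0 \<le> r" "r \<le> t" for s r
  proof -
    have "norm (s *\<^sub>R v + r *\<^sub>R w) \<le> s * norm v + r * norm w"
      using norm_triangle_ineq [of "s *\<^sub>R v" "r *\<^sub>R w"] that by simp
    also have "\<dots> \<le> t * norm v + t * norm w"
      using that by (intro add_mono mult_right_mono) auto
    also have "\<dots> < t * (2 * (norm v + norm w + 1))"
    proof -
      have "0 \<le> t * norm v" "0 \<le> t * norm w"
        using t by simp_all
      then show ?thesis
        unfolding distrib_left using t by linarith
    qed
    also have "\<dots> = d"
    proof -
      have "2 * (norm v + norm w + 1) > 0"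
        by (simp add: add_nonneg_pos)
      then show ?thesis by (simp add: t_def)
    qed
    finally show ?thesis
      by (simp add: dist_norm add.assoc)
  qed
  obtain s r where "0 \<le> s" "s \<le> t" "0 \<le> r" "r \<le> t" and
    1: "F (x + t *\<^sub>R v + t *\<^sub>R w) - F (x + t *\<^sub>R v) - F (x + t *\<^sub>R w) + F x
      = t\<^sup>2 * A (x + s *\<^sub>R v + r *\<^sub>R w) w"
    by (rule second_difference_mvt [OF t _ F A, where x = x and w = w and U = U]) (use near dU in \<open>auto simp: d_def\<close>)
  then have a: "\<bar>A (x + s *\<^sub>R v + r *\<^sub>R w) w - A x w\<bar> < e"
    using near dA by (simp add: d_def)
  have near': "dist (x + s *\<^sub>R w + r *\<^sub>R v) x < d" if "0 \<le> s" "s \<le> t" "0 \<le> r" "r \<le> t" for s r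
    using near [OF that(3,4,1,2)] by (simp add: add.commute add.left_commute)
  obtain s' r' where "0 \<le> s'" "s' \<le> t" "0 \<le> r'" "r' \<le> t" and
    2: "F (x + t *\<^sub>R w + t *\<^sub>R v) - F (x + t *\<^sub>R w) - F (x + t *\<^sub>R v) + F x
      = t\<^sup>2 * B (x + s' *\<^sub>R w + r' *\<^sub>R v) v"
    by (rule second_difference_mvt [OF t _ F B, where x = x and w = v and U = U]) (use near' dU in \<open>auto simp: d_def\<close>)
  then have b: "\<bar>B (x + s' *\<^sub>R w + r' *\<^sub>R v) v - B x v\<bar> < e"
    using near' dB by (simp add: d_def)
  have "t\<^sup>2 * A (x + s *\<^sub>R v + r *\<^sub>R w) w = t\<^sup>2 * B (x + s' *\<^sub>R w + r' *\<^sub>R v) v"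
    using 1 2 by (simp add: algebra_simps)
  then have "A (x + s *\<^sub>R v + r *\<^sub>R w) w = B (x + s' *\<^sub>R w + r' *\<^sub>R v) v"
    using t by simp
  with a b show False
    unfolding e_def by (simp add: abs_if split: if_splits)
qed

lemma smooth_on_second_derivative_symmetric:
  fixes f :: "'a::euclidean_space \<Rightarrow> 'b::euclidean_space"
  assumes f: "smooth_on f U" and U: "open U" "x \<in> U"
  shows "frechet_derivative (\<lambda>y. frechet_derivative f (at y) v) (at x) w
       = frechet_derivative (\<lambda>y. frechet_derivative f (at y) w) (at x) v"
proof (rule euclidean_eqI)
  fix i :: 'b
  let ?f' = "\<lambda>y. frechet_derivative f (at y)"
  have k: "Ck_on (Suc (Suc 0)) f U"
    using f by (simp add: smooth_on_def del: Ck_on.simps)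
  then have d1: "\<And>y. y \<in> U \<Longrightarrow> (f has_derivative ?f' y) (at y)"
    and d2: "\<And>y v. y \<in> U \<Longrightarrow> ((\<lambda>y. ?f' y v) has_derivative frechet_derivative (\<lambda>y. ?f' y v) (at y)) (at y)"
    and c: "\<And>v w. continuous_on U (\<lambda>y. frechet_derivative (\<lambda>y. ?f' y v) (at y) w)"
    by (auto simp: frechet_derivative_works)
  show "frechet_derivative (\<lambda>y. ?f' y v) (at x) w \<bullet> i = frechet_derivative (\<lambda>y. ?f' y w) (at x) v \<bullet> i"
    by (rule second_derivative_symmetric_real
        [OF U, of "\<lambda>y. f y \<bullet> i" "\<lambda>y v. ?f' y v \<bullet> i"
          v "\<lambda>y w. frechet_derivative (\<lambda>y. ?f' y v) (at y) w \<bullet> i"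
          w "\<lambda>y v. frechet_derivative (\<lambda>y. ?f' y w) (at y) v \<bullet> i"])
      (use U in \<open>auto intro!: has_derivative_inner_left d1 d2 continuous_inner continuous_const
        continuous_on_interior [OF c] simp: interior_open\<close>)
qed

section \<open>Tangent spaces and moving frames\<close>

lemma range_derivative_subset:
  fixes f :: "'a::euclidean_space \<Rightarrow> 'c::euclidean_space" and h :: "'b::euclidean_space \<Rightarrow> 'c"
  assumes f: "(f has_derivative f') (at u)" "inj f'"
    and h: "(h has_derivative h') (at w)"
    and \<tau>: "continuous (at w) \<tau>" "\<tau> w = u"
    and W: "open W" "w \<in> W" "\<And>y. y \<in> W \<Longrightarrow> h y = f (\<tau> y)"
  shows "range h' \<subseteq> range f'"
proof
  fix a assume "a \<in> range h'"
  then obtain d where d: "a = h' d" by blast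
  have lin: "linear f'" "linear h'"
    using f h by (auto intro: has_derivative_linear)
  \<comment> \<open>The orthogonal splitting of h' d along the range of f'; the aim is c =
    0.\<close>
  obtain b c where bc: "b \<in> span (range f')" "\<And>y. y \<in> span (range f') \<Longrightarrow> orthogonal c y" "a = b + c"
    using orthogonal_subspace_decomp_exists by blast
  have cf: "c \<bullet> f' v = 0" for v
    using bc(2) [of "f' v"] by (simp add: span_base orthogonal_def)
  obtain B where B: "B > 0" "\<And>v. B * norm v \<le> norm (f' v)"
    using linear_inj_bounded_below_pos [OF lin(1) f(2)] by blast
  obtain K where K: "K > 0" "\<And>v. norm (h' v) \<le> K * norm v"
    using linear_bounded_pos [OF lin(2)] by blast
  obtain d1 where d1: "d1 > 0" "\<And>y. norm (y - u) < d1 \<Longrightarrow> norm (f y - f u - f' (y - u)) \<le> B/2 * norm (y - u)"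
    using f(1) B(1) unfolding has_derivative_at_alt by (meson half_gt_zero)
  obtain d2 where d2: "d2 > 0" "\<And>y. norm (y - w) < d2 \<Longrightarrow> norm (h y - h w - h' (y - w)) \<le> 1 * norm (y - w)"
    using h unfolding has_derivative_at_alt by (meson zero_less_one)
  obtain d3 where d3: "d3 > 0" "\<And>y. norm (y - w) < d3 \<Longrightarrow> y \<in> W"
    using W(1,2) unfolding open_dist by (auto simp: dist_norm)
  have hw: "h w = f u" using W \<tau> by simp
  have kf: "((\<lambda>y. c \<bullet> f y) has_derivative (\<lambda>v. 0)) (at u)"
    using has_derivative_inner_right [OF f(1), of c] by (simp add: cf)
  have "((\<lambda>y. c \<bullet> h y) has_derivative (\<lambda>v. 0)) (at w)"
    unfolding has_derivative_at_alt
  proof (intro conjI allI impI)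
    fix e :: real assume "e > 0"
    \<comment> \<open>Scaled so that the estimate |\<tau> y - u| \<le> 2 (K + 1) / B * |y - w| turns
      the error \<open>e'\<close> in the parameter u into the error e in the parameter w.\<close>
    define e' where "e' = e / (K + 1) * (B/2)"
    have e': "e' > 0" using \<open>e > 0\<close> B K by (simp add: e'_def)
    obtain d4 where d4: "d4 > 0" "\<And>y. norm (y - u) < d4 \<Longrightarrow> \<bar>c \<bullet> f y - c \<bullet> f u\<bar> \<le> e' * norm (y - u)"
      using kf e' unfolding has_derivative_at_alt by auto
    obtain d5 where d5: "d5 > 0" "\<And>y. norm (y - w) < d5 \<Longrightarrow> norm (\<tau> y - u) < min d1 d4"
      using \<tau> d1 d4 unfolding continuous_at_eps_delta dist_norm by (metis min_less_iff_conj)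
    have "norm (c \<bullet> h y - c \<bullet> h w - 0) \<le> e * norm (y - w)" if y: "norm (y - w) < min d2 (min d3 d5)" for y
    proof -
      have hy: "h y = f (\<tau> y)" using W(3) d3 y by auto
      \<comment> \<open>The linearisation error is at most half of the lower bound B for f', so it
        can be absorbed on the left.\<close>
      have "B * norm (\<tau> y - u) \<le> norm (f (\<tau> y) - f u) + B/2 * norm (\<tau> y - u)"
        using B(2) [of "\<tau> y - u"] d1(2) [of "\<tau> y"] d5(2) [of y] y
          norm_triangle_ineq3 [of "f (\<tau> y) - f u" "f' (\<tau> y - u)"] by simp
      also have "norm (f (\<tau> y) - f u) \<le> (K + 1) * norm (y - w)"
        using K(2) [of "y - w"] d2(2) [of y] y hy hw
          norm_triangle_ineq2 [of "h y - h w" "h' (y - w)"] by (simp add: distrib_right)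
      finally have "B/2 * norm (\<tau> y - u) \<le> (K + 1) * norm (y - w)"
        by simp
      then have "e / (K + 1) * (B/2 * norm (\<tau> y - u)) \<le> e / (K + 1) * ((K + 1) * norm (y - w))"
        using \<open>e > 0\<close> K by (intro mult_left_mono) auto
      moreover have "e' * norm (\<tau> y - u) = e / (K + 1) * (B/2 * norm (\<tau> y - u))"
        "e / (K + 1) * ((K + 1) * norm (y - w)) = e * norm (y - w)"
        using K by (simp_all add: e'_def mult.assoc)
      ultimately have "e' * norm (\<tau> y - u) \<le> e * norm (y - w)"
        by simp
      moreover have "\<bar>c \<bullet> f (\<tau> y) - c \<bullet> f u\<bar> \<le> e' * norm (\<tau> y - u)"
        using d4(2) d5(2) y by auto
      ultimately show ?thesis by (simp add: hy hw)
    qed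
    then show "\<exists>d>0. \<forall>y. norm (y - w) < d \<longrightarrow> norm (c \<bullet> h y - c \<bullet> h w - 0) \<le> e * norm (y - w)"
      using d2 d3 d5 by (intro exI [of _ "min d2 (min d3 d5)"]) auto
  qed simp
  moreover have "((\<lambda>y. c \<bullet> h y) has_derivative (\<lambda>v. c \<bullet> h' v)) (at w)"
    using h by (rule has_derivative_inner_right)
  ultimately have "c \<bullet> h' d = 0"
    by (metis has_derivative_unique)
  moreover have "c \<bullet> b = 0"
    using bc(1,2) by (simp add: orthogonal_def)
  moreover have "c \<bullet> h' d = c \<bullet> b + c \<bullet> c"
    using d bc(3) by (simp flip: inner_add_right)
  ultimately have "c = 0"
    by simp
  then have "a \<in> span (range f')" using bc by simp
  moreover have "subspace (range f')"
    using lin(1) by (simp add: linear_subspace_image)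
  ultimately show "a \<in> range f'"
    by (simp add: span_eq_iff [THEN iffD2])
qed

lemma param_smooth: "param T \<iota> U \<phi> \<Longrightarrow> u \<in> U \<Longrightarrow>
    ((\<iota> \<circ> \<phi>) has_derivative frechet_derivative (\<iota> \<circ> \<phi>) (at u)) (at u)"
  unfolding param_def smooth_on_def by (metis Ck_on.simps(2) frechet_derivative_works)

text \<open>The definition of the tangent space ranges over all parametrizations. Two of them
  through the same point differ by a continuous change of parameters, because parametrizations are
  embeddings with open image, and \<open>range_derivative_subset\<close> compares their
  derivatives.\<close>

lemma tangent_param:
  assumes p: "param T \<iota> U \<phi>" and u: "u \<in> U"
  shows "tangent T \<iota> (\<phi> u) = range (frechet_derivative (\<iota> \<circ> \<phi>) (at u))"
proof
  show "range (frechet_derivative (\<iota> \<circ> \<phi>) (at u)) \<subseteq> tangent T \<iota> (\<phi> u)"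
    using assms by (auto simp: tangent_def)
  have "range (frechet_derivative (\<iota> \<circ> \<psi>) (at w)) \<subseteq> range (frechet_derivative (\<iota> \<circ> \<phi>) (at u))"
    if q: "param T \<iota> V \<psi>" and w: "w \<in> V" "\<psi> w = \<phi> u" for V \<psi> w
  proof -
    have "homeomorphic_map (top_of_set U) (subtopology T (\<phi> ` U)) \<phi>"
      using p by (simp add: param_def embedding_map_def)
    then obtain \<kappa> where "homeomorphic_maps (top_of_set U) (subtopology T (\<phi> ` U)) \<phi> \<kappa>"
      by (auto simp: homeomorphic_map_maps)
    then have \<kappa>: "continuous_map (subtopology T (\<phi> ` U)) (top_of_set U) \<kappa>" "\<And>y. y \<in> U \<Longrightarrow> \<kappa> (\<phi> y) = y"
      by (auto simp: homeomorphic_maps_def)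
    have c: "continuous_map (top_of_set V) T \<psi>"
      using q unfolding param_def embedding_map_def
      by (blast intro: homeomorphic_imp_continuous_map continuous_map_into_fulltopology)
    \<comment> \<open>The part of V on which the change of parameters is defined; it is open because
      \<psi> is continuous and the image of U is open in T.\<close>
    define W where "W = {y \<in> V. \<psi> y \<in> \<phi> ` U}"
    have "openin (top_of_set V) W"
      using openin_continuous_map_preimage [OF c, of "\<phi> ` U"] p by (simp add: W_def param_def)
    then have W: "open W"
      using q by (meson openin_open_eq param_def openin_open_trans)
    have "continuous_map (top_of_set W) (subtopology T (\<phi> ` U)) \<psi>"
      using continuous_map_from_subtopology [OF c, of W]
      by (auto simp: continuous_map_in_subtopology subtopology_subtopology W_def Int_absorb1)
    then have "continuous_map (top_of_set W) (top_of_set U) (\<kappa> \<circ> \<psi>)"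
      using \<kappa>(1) continuous_map_compose by blast
    then have "continuous_on W (\<kappa> \<circ> \<psi>)"
      by (simp add: continuous_map_in_subtopology)
    moreover have "w \<in> W"
      using w u by (auto simp: W_def)
    ultimately have "continuous (at w) (\<kappa> \<circ> \<psi>)"
      using W continuous_on_eq_continuous_at by blast
    then show ?thesis
      using param_smooth [OF p u] param_smooth [OF q w(1)] p u w W \<open>w \<in> W\<close> \<kappa>(2)
      by (intro range_derivative_subset [where f = "\<iota> \<circ> \<phi>" and h = "\<iota> \<circ> \<psi>" and \<tau> = "\<kappa> \<circ> \<psi>" and W = W and w = w and u = u])
        (auto simp: param_def W_def)
  qed
  then show "tangent T \<iota> (\<phi> u) \<subseteq> range (frechet_derivative (\<iota> \<circ> \<phi>) (at u))"
    unfolding tangent_def by blast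
qed

section \<open>The structure equations and the final contradiction\<close>

lemma bilinear_coframe: "bilinear coframe"
  unfolding bilinear_def
  by (intro conjI allI linear_coframe linearI)
    (simp_all add: coframe_def linear_add [OF linear_qcnj] linear_scale [OF linear_qcnj] qmult_left_simps)

text \<open>The factors p cancel in conj(pa) pb = conj(a) b, and for imaginary a, b the imaginary
  part of conj(a) b is - a \<times> b. This is the quadratic term of the Maurer-Cartan
  equation.\<close>

lemma coframe_frame_frame:
  assumes "z \<in> S3S3"
  shows "coframe (frame z A) (frame z B) = - (cross3 (fst A) (fst B), cross3 (snd A) (snd B))"
proof -
  have "qcnj (x \<odot> y) = qcnj y \<odot> qcnj x" for x y
    by (auto simp: quat_simps algebra_simps)
  then have "qcnj (p \<odot> a) \<odot> (p \<odot> b) = qcnj a \<odot> b" if "norm p = 1" for p a b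
    by (simp add: qmult_assoc qmult_cancel that)
  then show ?thesis
    using norm_S3S3 [OF assms] by (simp add: coframe_def frame_def) (simp add: qmult_def qcnj_def)
qed

lemma has_derivative_zero_on_open:
  assumes "(g has_derivative g') (at x)" "open U" "x \<in> U" "\<And>y. y \<in> U \<Longrightarrow> g y = (0 :: real)"
  shows "g' w = 0"
proof -
  have "((\<lambda>_. 0) has_derivative g') (at x)"
    using has_derivative_transform_within_open [OF assms(1,2,3)] assms(4) by simp
  then have "g' = (\<lambda>_. 0)"
    using has_derivative_const has_derivative_unique by blast
  then show ?thesis by simp
qed

text \<open>\<open>h1\<close> to \<open>h3\<close> are linear equations satisfied by the multiples
  of (c, 0), (0, c) and (\<beta>, \<gamma>). They involve only \<beta> and \<gamma>, so the
  direction c is never differentiated. Antisymmetrising their derivatives removes the second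
  derivatives of f and leaves algebraic relations at \<open>u0\<close>.\<close>

lemma no_moving_frame:
  fixes f :: "real^3 \<Rightarrow> quat2"
  assumes f: "smooth_on f U" and U: "open U" "u0 \<in> U"
    and S: "\<And>u. u \<in> U \<Longrightarrow> f u \<in> S3S3"
    and tan: "\<And>v. frechet_derivative f (at u0) v \<in> tangent_S3S3 (f u0)"
    and \<beta>: "(\<beta> has_derivative \<beta>') (at u0)" and \<gamma>: "(\<gamma> has_derivative \<gamma>') (at u0)"
    and n1: "\<And>u. u \<in> U \<Longrightarrow> \<beta> u \<bullet> \<beta> u = \<gamma> u \<bullet> \<gamma> u"
    and n2: "\<And>u. u \<in> U \<Longrightarrow> 2 * (\<beta> u \<bullet> \<gamma> u) = \<beta> u \<bullet> \<beta> u"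
    and A_def: "\<And>u v. A u v = coframe (f u) (frechet_derivative f (at u) v)"
    and h1: "\<And>u v. u \<in> U \<Longrightarrow> fst (A u v) \<bullet> (2 *\<^sub>R \<gamma> u - \<beta> u) = 0"
    and h2: "\<And>u v. u \<in> U \<Longrightarrow> snd (A u v) \<bullet> (\<gamma> u - 2 *\<^sub>R \<beta> u) = 0"
    and h3: "\<And>u v. u \<in> U \<Longrightarrow> fst (A u v) \<bullet> \<beta> u - snd (A u v) \<bullet> \<gamma> u = 0"
    and v: "A u0 v1 = (c, 0)" "A u0 v2 = (0, c)" "A u0 v3 = (\<beta> u0, \<gamma> u0)"
    and c: "c \<noteq> 0" "c \<bullet> \<beta> u0 = 0" "c \<bullet> \<gamma> u0 = 0"
    and ne: "\<beta> u0 \<noteq> 0"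
  shows False
proof -
  let ?f' = "\<lambda>u. frechet_derivative f (at u)"
  \<comment> \<open>The derivative of \<open>A u v\<close> in direction w splits by the product
    rule: s carries the second derivative of f and is symmetric in v and w, while the cross products
    in \<open>E\<close> come from moving the base point.\<close>
  define s where "s v w = coframe (f u0) (frechet_derivative (\<lambda>u. ?f' u v) (at u0) w)" for v w
  define E where "E v w = - (cross3 (fst (A u0 w)) (fst (A u0 v)), cross3 (snd (A u0 w)) (snd (A u0 v))) + s v w"
    for v w
  have sym: "s v w = s w v" for v w
    by (simp add: s_def smooth_on_second_derivative_symmetric [OF f U, of v w])
  have dA: "((\<lambda>u. A u v) has_derivative E v) (at u0)" for v
  proof -
    have "Ck_on (Suc (Suc 0)) f U"
      using f by (simp add: smooth_on_def del: Ck_on.simps)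
    then have d: "(f has_derivative ?f' u0) (at u0)"
      "((\<lambda>u. ?f' u v) has_derivative frechet_derivative (\<lambda>u. ?f' u v) (at u0)) (at u0)"
      using U(2) by (auto simp: frechet_derivative_works)
    have A: "frame (f u0) (A u0 w) = ?f' u0 w" for w
      unfolding A_def using tan S U by (simp add: frame_coframe)
    have "coframe (?f' u0 w) (?f' u0 v)
        = - (cross3 (fst (A u0 w)) (fst (A u0 v)), cross3 (snd (A u0 w)) (snd (A u0 v)))" for w
      unfolding A [symmetric] using S U by (simp add: coframe_frame_frame)
    with bounded_bilinear.FDERIV [OF bilinear_conv_bounded_bilinear [THEN iffD1, OF bilinear_coframe] d]
    show ?thesis
      by (simp add: A_def E_def [abs_def] s_def add.commute)
  qed
  have N1: "2 * (\<beta> u0 \<bullet> \<beta>' w) = 2 * (\<gamma> u0 \<bullet> \<gamma>' w)" for w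
  proof -
    have "((\<lambda>u. \<beta> u \<bullet> \<beta> u - \<gamma> u \<bullet> \<gamma> u) has_derivative
        (\<lambda>w. (\<beta> u0 \<bullet> \<beta>' w + \<beta>' w \<bullet> \<beta> u0) - (\<gamma> u0 \<bullet> \<gamma>' w + \<gamma>' w \<bullet> \<gamma> u0))) (at u0)"
      by (intro has_derivative_diff has_derivative_inner \<beta> \<gamma>)
    from has_derivative_zero_on_open [OF this U, of w] n1 show ?thesis
      by (simp add: inner_commute)
  qed
  have N2: "2 * (\<beta> u0 \<bullet> \<gamma>' w) + 2 * (\<gamma> u0 \<bullet> \<beta>' w) = 2 * (\<beta> u0 \<bullet> \<beta>' w)" for w
  proof -
    have "((\<lambda>u. 2 * (\<beta> u \<bullet> \<gamma> u) - \<beta> u \<bullet> \<beta> u) has_derivative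
        (\<lambda>w. 2 * (\<beta> u0 \<bullet> \<gamma>' w + \<beta>' w \<bullet> \<gamma> u0) - (\<beta> u0 \<bullet> \<beta>' w + \<beta>' w \<bullet> \<beta> u0))) (at u0)"
      by (intro has_derivative_diff has_derivative_inner has_derivative_mult_right \<beta> \<gamma>)
    from has_derivative_zero_on_open [OF this U, of w] n2 show ?thesis
      by (simp add: inner_commute)
  qed
  have H1: "fst (A u0 v) \<bullet> (2 *\<^sub>R \<gamma>' w - \<beta>' w) + fst (E v w) \<bullet> (2 *\<^sub>R \<gamma> u0 - \<beta> u0) = 0" for v w
  proof -
    have "((\<lambda>u. fst (A u v) \<bullet> (2 *\<^sub>R \<gamma> u - \<beta> u)) has_derivative
        (\<lambda>w. fst (A u0 v) \<bullet> (2 *\<^sub>R \<gamma>' w - \<beta>' w) + fst (E v w) \<bullet> (2 *\<^sub>R \<gamma> u0 - \<beta> u0))) (at u0)"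
      by (intro has_derivative_diff has_derivative_inner has_derivative_scaleR_right has_derivative_fst dA \<beta> \<gamma>)
    from has_derivative_zero_on_open [OF this U h1] show ?thesis .
  qed
  have H2: "snd (A u0 v) \<bullet> (\<gamma>' w - 2 *\<^sub>R \<beta>' w) + snd (E v w) \<bullet> (\<gamma> u0 - 2 *\<^sub>R \<beta> u0) = 0" for v w
  proof -
    have "((\<lambda>u. snd (A u v) \<bullet> (\<gamma> u - 2 *\<^sub>R \<beta> u)) has_derivative
        (\<lambda>w. snd (A u0 v) \<bullet> (\<gamma>' w - 2 *\<^sub>R \<beta>' w) + snd (E v w) \<bullet> (\<gamma> u0 - 2 *\<^sub>R \<beta> u0))) (at u0)"
      by (intro has_derivative_diff has_derivative_inner has_derivative_scaleR_right has_derivative_snd dA \<beta> \<gamma>)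
    from has_derivative_zero_on_open [OF this U h2] show ?thesis .
  qed
  have H3: "(fst (A u0 v) \<bullet> \<beta>' w + fst (E v w) \<bullet> \<beta> u0) - (snd (A u0 v) \<bullet> \<gamma>' w + snd (E v w) \<bullet> \<gamma> u0) = 0" for v w
  proof -
    have "((\<lambda>u. fst (A u v) \<bullet> \<beta> u - snd (A u v) \<bullet> \<gamma> u) has_derivative
        (\<lambda>w. (fst (A u0 v) \<bullet> \<beta>' w + fst (E v w) \<bullet> \<beta> u0) - (snd (A u0 v) \<bullet> \<gamma>' w + snd (E v w) \<bullet> \<gamma> u0))) (at u0)"
      by (intro has_derivative_diff has_derivative_inner has_derivative_fst has_derivative_snd dA \<beta> \<gamma>)
    from has_derivative_zero_on_open [OF this U h3] show ?thesis .
  qed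
  let ?X = "cross3 c (\<beta> u0)" and ?Y = "cross3 c (\<gamma> u0)"
  have skew: "cross3 (\<beta> u0) c = - ?X" "cross3 (\<gamma> u0) c = - ?Y"
    by (simp_all add: cross_skew [of _ c])
  note ex = E_def v skew inner_diff_left inner_diff_right inner_add_left inner_add_right dot_cross_self
  \<comment> \<open>Subtract the two instances of \<open>H3\<close>. The symmetric part s cancels,
    the cross product of c and \<beta> is orthogonal to \<beta>, and the terms \<beta> \<bullet>
    \<beta>' and \<gamma> \<bullet> \<gamma>' cancel by \<open>N1\<close>.\<close>
  have a3: "c \<bullet> \<beta>' v3 = 0"
    using H3 [of v1 v3] H3 [of v3 v1] N1 [of v1] sym [of v1 v3] by (simp add: ex)
  have A3: "c \<bullet> \<gamma>' v3 = 0"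
    using H3 [of v2 v3] H3 [of v3 v2] N1 [of v2] sym [of v2 v3] by (simp add: ex)
  \<comment> \<open>With \<open>a3\<close> and \<open>A3\<close>, antisymmetrising \<open>H1\<close>
    gives \<beta> \<bullet> (2\<gamma>' - \<beta>') = 4 (c \<times> \<beta>) \<bullet> \<gamma> and
    antisymmetrising \<open>H2\<close> gives \<gamma> \<bullet> (\<gamma>' - 2\<beta>') = 0, the
    derivatives being taken along \<open>v1\<close>. By \<open>N1\<close> and \<open>N2\<close> the
    two left sides agree.\<close>
  have "?X \<bullet> \<gamma> u0 = 0"
    using H1 [of v1 v3] H1 [of v3 v1] H2 [of v1 v3] H2 [of v3 v1] N1 [of v1] N2 [of v1]
      sym [of v1 v3] a3 A3 by (simp add: ex)
  moreover define p q r where "p = \<beta> u0" and "q = \<gamma> u0" and "r = p \<bullet> p"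
  ultimately have X: "cross3 c p \<bullet> q = 0" and cp: "c \<bullet> p = 0" "c \<bullet> q = 0"
    using c by auto
  have pq: "q \<bullet> q = r" "2 * (p \<bullet> q) = r"
    using n1 [of u0] n2 [of u0] U by (simp_all add: p_def q_def r_def)
  have "r > 0" using ne by (simp add: p_def r_def)
  \<comment> \<open>The squared triple product is the Gram determinant of c, p, q, expanded along
    its first row. As c is orthogonal to p and q, its vanishing forces r^2 = (p \<bullet> q)^2,
    whereas p \<bullet> q = r/2.\<close>
  have "(cross3 c p \<bullet> q)\<^sup>2 = (c \<bullet> c) * ((p \<bullet> p) * (q \<bullet> q) - (p \<bullet> q)\<^sup>2)
      - (c \<bullet> p) * ((c \<bullet> p) * (q \<bullet> q) - (p \<bullet> q) * (c \<bullet> q))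
      + (c \<bullet> q) * ((c \<bullet> p) * (p \<bullet> q) - (p \<bullet> p) * (c \<bullet> q))"
    by (simp add: cross3_def inner_vec_def sum_3 vector_def power2_eq_square algebra_simps)
  then have "(c \<bullet> c) * ((p \<bullet> p) * (q \<bullet> q) - (p \<bullet> q)\<^sup>2) = 0"
    using X cp by simp
  then have "r * r = (p \<bullet> q)\<^sup>2"
    using c(1) pq by (simp add: r_def)
  then have "4 * (r * r) = r * r"
    using pq(2) by (metis power2_eq_square power_mult_distrib four_x_squared)
  then show False using \<open>r > 0\<close> by simp
qed

section \<open>Position and dimension of the tangent spaces\<close>

lemma param_tangent_facts:
  assumes M: "submanifold3 T \<iota>" and p: "param T \<iota> U \<phi>" and u: "u \<in> U"
  shows "\<phi> u \<in> topspace T" "\<iota> (\<phi> u) \<in> S3S3"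
    "tangent T \<iota> (\<phi> u) \<subseteq> tangent_S3S3 (\<iota> (\<phi> u))"
    "subspace (tangent T \<iota> (\<phi> u))" "dim (tangent T \<iota> (\<phi> u)) = 3"
proof -
  let ?f = "\<iota> \<circ> \<phi>" let ?f' = "frechet_derivative ?f (at u)"
  have top: "\<phi> y \<in> topspace T" if "y \<in> U" for y
    using p that openin_subset unfolding param_def by blast
  then have S: "?f y \<in> S3S3" if "y \<in> U" for y
    using M that unfolding submanifold3_def by auto
  show "\<phi> u \<in> topspace T" "\<iota> (\<phi> u) \<in> S3S3"
    using top S u by auto
  note d = param_smooth [OF p u]
  have lin: "linear ?f'" and inj: "inj ?f'" and U: "open U"
    using d p u by (auto intro: has_derivative_linear simp: param_def)
  have "?f' v \<in> tangent_S3S3 (?f u)" for v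
  proof -
    have "((\<lambda>y. fst (?f y) \<bullet> fst (?f y) - 1) has_derivative
        (\<lambda>v. fst (?f u) \<bullet> fst (?f' v) + fst (?f' v) \<bullet> fst (?f u) - 0)) (at u)"
      "((\<lambda>y. snd (?f y) \<bullet> snd (?f y) - 1) has_derivative
        (\<lambda>v. snd (?f u) \<bullet> snd (?f' v) + snd (?f' v) \<bullet> snd (?f u) - 0)) (at u)"
      by (intro has_derivative_diff has_derivative_inner has_derivative_const
          has_derivative_fst has_derivative_snd d)+
    from this [THEN has_derivative_zero_on_open, OF U u, of v] norm_S3S3 [OF S]
    show ?thesis
      using S [OF u] by (simp add: tangent_S3S3_iff norm_eq_1 inner_commute)
  qed
  then show "tangent T \<iota> (\<phi> u) \<subseteq> tangent_S3S3 (\<iota> (\<phi> u))"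
    by (auto simp: tangent_param [OF p u])
  show "subspace (tangent T \<iota> (\<phi> u))"
    using lin by (simp add: tangent_param [OF p u] linear_subspace_image)
  have "dim (?f' ` UNIV) = dim (UNIV :: (real^3) set)"
    using lin inj by (intro dim_image_eq) (auto intro: inj_on_subset)
  then show "dim (tangent T \<iota> (\<phi> u)) = 3"
    by (simp add: tangent_param [OF p u])
qed

section \<open>Invariant planes and the complement of \<open>D1\<close>\<close>

lemma dim_frame_vimage:
  assumes "z \<in> S3S3" "X \<subseteq> tangent_S3S3 z" "subspace X"
  shows "frame z ` (frame z -` X) = X" "subspace (frame z -` X)" "dim (frame z -` X) = dim X"
proof -
  show 1: "frame z ` (frame z -` X) = X"
    using assms(2) by (auto simp: tangent_S3S3_eq_frame)
  show "subspace (frame z -` X)"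
    using assms(3) linear_frame by (metis linear_subspace_vimage)
  have "dim (frame z ` (frame z -` X)) = dim (frame z -` X)"
    using inj_frame [OF assms(1)] linear_frame by (intro dim_image_eq) (auto intro: inj_on_subset)
  with 1 show "dim (frame z -` X) = dim X" by simp
qed

lemma frame_vimage_nk_J:
  assumes "z \<in> S3S3" "X \<subseteq> tangent_S3S3 z"
  shows "frame z -` (nk_J z ` X) = J0 ` (frame z -` X)"
proof -
  have X: "X = frame z ` (frame z -` X)"
    using assms(2) by (auto simp: tangent_S3S3_eq_frame)
  have "nk_J z ` frame z ` B = frame z ` J0 ` B" for B
    by (simp add: image_image nk_J_frame assms(1))
  with X have "nk_J z ` X = frame z ` (J0 ` (frame z -` X))"
    by metis
  then show ?thesis
    by (simp add: inj_vimage_image_eq inj_frame assms(1))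
qed

lemma frame_vimage_nk_P:
  assumes "z \<in> S3S3" "X \<subseteq> tangent_S3S3 z"
  shows "frame z -` (nk_P z ` X) = prod.swap ` (frame z -` X)"
proof -
  have X: "X = frame z ` (frame z -` X)"
    using assms(2) by (auto simp: tangent_S3S3_eq_frame)
  have "nk_P z ` frame z ` B = frame z ` prod.swap ` B" for B
    by (simp add: image_image nk_P_frame assms(1))
  with X have "nk_P z ` X = frame z ` (prod.swap ` (frame z -` X))"
    by metis
  then show ?thesis
    by (simp add: inj_vimage_image_eq inj_frame assms(1))
qed

text \<open>\<open>J0 e\<close> is orthogonal to e for the positive definite form \<open>g0\<close>,
  and it is nonzero because \<open>J0\<close> squares to -1.\<close>

lemma J0_not_in_span:
  assumes "e \<noteq> 0"
  shows "J0 e \<notin> span {e}"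
proof
  assume "J0 e \<in> span {e}"
  then obtain l where l: "J0 e = l *\<^sub>R e"
    by (auto simp: span_singleton)
  have "g0 (J0 e) e = 0"
    using g0_J0 [of e e] g0_sym [of e "J0 e"] by simp
  then have "l * g0 e e = 0"
    by (simp add: l bilinear_lmul [OF bilinear_g0])
  then have "J0 e = 0"
    using g0_pos [OF assms] l by auto
  then have "e = 0"
    using J0_J0 [of e] linear_0 [OF linear_J0] by simp
  with assms show False by simp
qed

lemma J0_invariant_plane:
  assumes S: "subspace S" "dim S = 2" "J0 ` S \<subseteq> S" and e: "e \<in> S" "e \<noteq> 0"
  shows "S = span {e, J0 e}"
proof -
  have "dim {e, J0 e} = 2"
    using J0_not_in_span [OF e(2)] e(2) by (simp add: insert_commute [of e] dim_insert)
  moreover have "span {e, J0 e} \<subseteq> S"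
    using S e by (intro span_minimal) auto
  ultimately show ?thesis
    using S subspace_dim_equal [of "span {e, J0 e}" S] by simp
qed

lemma dim_pos_nonzero: "dim S > 0 \<Longrightarrow> \<exists>e\<in>S. e \<noteq> 0" for S :: "'a::euclidean_space set"
  by (metis bot_nat_0.not_eq_extremum dim_eq_0 singleton_iff subsetI)

text \<open>If w and \<open>J0 w\<close> lie in V, remove from w its projection to S. The remainder
  n is orthogonal to S and \<open>J0 n\<close> lies in V, so total reality of the complement makes
  \<open>J0 n\<close> orthogonal to itself.\<close>

lemma maximal_J0_invariant_subspace:
  assumes V: "subspace V" and S: "subspace S" "dim S = 2" "J0 ` S = S" "S \<subseteq> V"
    and n: "\<And>n w. n \<in> V \<Longrightarrow> (\<And>s. s \<in> S \<Longrightarrow> g0 n s = 0) \<Longrightarrow> w \<in> V \<Longrightarrow> g0 (J0 n) w = 0"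
  shows "J0 ` V \<inter> V = S"
proof
  show "S \<subseteq> J0 ` V \<inter> V"
    using S by blast
  obtain e where e: "e \<in> S" "e \<noteq> 0"
    using dim_pos_nonzero [of S] S by auto
  have Se: "S = span {e, J0 e}"
    using J0_invariant_plane S e by auto
  note g0_simps = bilinear_ladd [OF bilinear_g0] bilinear_radd [OF bilinear_g0]
    bilinear_lsub [OF bilinear_g0] bilinear_rsub [OF bilinear_g0]
    bilinear_lmul [OF bilinear_g0] bilinear_rmul [OF bilinear_g0]
  have ee: "g0 e (J0 e) = 0" "g0 (J0 e) e = 0" "g0 (J0 e) (J0 e) = g0 e e" "g0 e e \<noteq> 0"
    using g0_J0 [of e e] g0_sym [of e "J0 e"] g0_pos [OF e(2)] g0_J0_J0 [of e e] by auto
  show "J0 ` V \<inter> V \<subseteq> S"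
  proof
    fix v assume "v \<in> J0 ` V \<inter> V"
    then obtain w where w: "w \<in> V" "v = J0 w" "v \<in> V" by blast
    \<comment> \<open>The \<open>g0\<close>-orthogonal projection of w to S: e and
      \<open>J0 e\<close> are orthogonal and of equal length.\<close>
    define d where "d = (g0 w e / g0 e e) *\<^sub>R e + (g0 w (J0 e) / g0 e e) *\<^sub>R J0 e"
    have d: "d \<in> S"
      unfolding d_def Se by (intro span_add span_scale span_base) auto
    have "g0 (w - d) e = 0" "g0 (w - d) (J0 e) = 0"
      using ee by (simp_all add: d_def g0_simps)
    then have "g0 (w - d) s = 0" if "s \<in> S" for s
      using that unfolding Se by (auto simp: span_insert span_singleton g0_simps algebra_simps eq_diff_eq)
    moreover have "w - d \<in> V" "J0 (w - d) \<in> V"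
      using V S d w by (auto simp: linear_diff [OF linear_J0] intro!: subspace_diff)
    ultimately have "g0 (J0 (w - d)) (J0 (w - d)) = 0"
      using n by blast
    then have "w = d"
      using g0_pos [of "w - d"] by (auto simp: g0_J0_J0)
    then show "v \<in> S"
      using w d S by blast
  qed
qed

lemma dim_axes:
  fixes c :: "real^3"
  assumes "c \<noteq> 0"
  shows "dim {(c, 0 :: real^3), (0, c)} = 2"
proof -
  have "(0, c) \<notin> span {(c, 0)}"
    using assms by (auto simp: span_singleton)
  then have "dim {(0, c), (c, 0)} = 2"
    using assms by (simp add: dim_insert zero_prod_def)
  then show ?thesis
    by (simp add: insert_commute)
qed

text \<open>Symmetrising under the swap yields some (c, c) in S. If e is antisymmetric its
  symmetrisation is zero, but then \<open>J0 e\<close> is itself symmetric. Since \<open>J0\<close>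
  maps (c, c) to a multiple of (c, - c), both axis vectors follow.\<close>

lemma J0_swap_invariant_plane:
  assumes S: "subspace S" "dim S = 2" "J0 ` S \<subseteq> S" "prod.swap ` S \<subseteq> S"
  obtains c where "c \<noteq> 0" "S = span {(c, 0), (0, c)}"
proof -
  obtain e where e: "e \<in> S" "e \<noteq> 0"
    using dim_pos_nonzero [of S] S by auto
  note S_closed = subspace_add [OF S(1)] subspace_diff [OF S(1)] subspace_scale [OF S(1)]
  have "\<exists>c. c \<noteq> 0 \<and> (c, c) \<in> S"
  proof (cases "fst e + snd e = 0")
    case False
    have "e + prod.swap e \<in> S"
      using S e by (intro S_closed) auto
    moreover have "e + prod.swap e = (fst e + snd e, fst e + snd e)"
      by (simp add: prod_eq_iff add.commute)
    ultimately show ?thesis using False by metis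
  next
    case True
    then have e': "snd e = - fst e"
      by (simp add: add_eq_0_iff)
    have "J0 e \<in> S"
      using S e by auto
    moreover have "J0 e = (- sqrt 3 *\<^sub>R fst e, - sqrt 3 *\<^sub>R fst e)"
      by (simp add: J0_def e' prod_eq_iff vec_eq_iff field_simps)
    moreover have "fst e \<noteq> 0"
      using e e' by (auto simp: prod_eq_iff)
    ultimately show ?thesis
      by (intro exI [of _ "- sqrt 3 *\<^sub>R fst e"]) auto
  qed
  then obtain c where c: "c \<noteq> 0" "(c, c) \<in> S" by blast
  have "J0 (c, c) \<in> S"
    using S c by auto
  then have "sqrt 3 *\<^sub>R J0 (c, c) \<in> S"
    by (rule S_closed)
  moreover have "sqrt 3 *\<^sub>R J0 (c, c) = (c, - c)"
    by (simp add: J0_def prod_eq_iff vec_eq_iff)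
  ultimately have "(1/2) *\<^sub>R ((c, c) + (c, - c)) \<in> S" "(1/2) *\<^sub>R ((c, c) - (c, - c)) \<in> S"
    using c by (auto intro!: S_closed simp del: add_Pair diff_Pair)
  then have mem: "(c, 0) \<in> S" "(0, c) \<in> S"
    by (simp_all flip: scaleR_2)
  have "dim {(c, 0), (0, c)} = 2"
    using c(1) by (rule dim_axes)
  moreover have "span {(c, 0), (0, c)} \<subseteq> S"
    using S mem by (intro span_minimal) auto
  ultimately have "S = span {(c, 0), (0, c)}"
    using S subspace_dim_equal [of "span {(c, 0), (0, c)}" S] by simp
  with c that show ?thesis by blast
qed

lemma span_axes: "span {(c, 0), (0, c)} = {(a *\<^sub>R c, b *\<^sub>R c) | a b. True}"
  by (auto simp: span_insert span_singleton eq_diff_eq prod_eq_iff)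

text \<open>A vector with both components orthogonal to c is \<open>g0\<close>-orthogonal to (c, 0)
  and (0, c). Together with these two it spans the three-dimensional tangent space, so it generates
  the complement of \<open>D1\<close>.\<close>

lemma complement_subset_line:
  assumes z: "\<iota> x \<in> S3S3"
    and T: "tangent T \<iota> x \<subseteq> tangent_S3S3 (\<iota> x)" "subspace (tangent T \<iota> x)" "dim (tangent T \<iota> x) = 3"
    and D: "frame (\<iota> x) -` D1 T \<iota> x = span {(c, 0), (0, c)}" "c \<noteq> 0"
    and X: "frame (\<iota> x) (\<beta>, \<gamma>) \<in> tangent T \<iota> x" "c \<bullet> \<beta> = 0" "c \<bullet> \<gamma> = 0" "(\<beta>, \<gamma>) \<noteq> 0"
  shows "frame (\<iota> x) Y \<in> tangent T \<iota> x \<Longrightarrow>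
      \<exists>a b t. Y = (a *\<^sub>R c + t *\<^sub>R \<beta>, b *\<^sub>R c + t *\<^sub>R \<gamma>)"
    and "v \<in> complement_in_tangent T \<iota> (D1 T \<iota>) x \<longleftrightarrow> (\<exists>t. v = t *\<^sub>R frame (\<iota> x) (\<beta>, \<gamma>))"
proof -
  define V where "V = frame (\<iota> x) -` tangent T \<iota> x"
  let ?S = "{(c, 0), (0, c)} :: vec2 set"
  note V = dim_frame_vimage(2,3) [OF z T(1,2), folded V_def]
  have Sm: "frame (\<iota> x) s \<in> D1 T \<iota> x \<longleftrightarrow> s \<in> span ?S" for s
    using D(1) by auto
  have SV: "span ?S \<subseteq> V"
    unfolding D(1) [symmetric] V_def D1_def by blast
  have Xn: "(\<beta>, \<gamma>) \<notin> span ?S"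
    using X D(2) by (auto simp: span_axes zero_prod_def)
  then have "dim (insert (\<beta>, \<gamma>) ?S) = 3"
    using dim_insert [of "(\<beta>, \<gamma>)" ?S] dim_axes [OF D(2)] by simp
  moreover have "span (insert (\<beta>, \<gamma>) ?S) \<subseteq> V"
    using V SV X(1) span_superset [of ?S] by (intro span_minimal) (auto simp: V_def)
  ultimately have V_eq: "V = span (insert (\<beta>, \<gamma>) ?S)"
    using V T(3) subspace_dim_equal [of "span (insert (\<beta>, \<gamma>) ?S)" V] by simp
  show Y: "\<exists>a b t. Y = (a *\<^sub>R c + t *\<^sub>R \<beta>, b *\<^sub>R c + t *\<^sub>R \<gamma>)" if "frame (\<iota> x) Y \<in> tangent T \<iota> x" for Y
  proof -
    have "Y \<in> V" using that by (simp add: V_def)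
    then obtain t where "Y - t *\<^sub>R (\<beta>, \<gamma>) \<in> span ?S"
      unfolding V_eq by (auto simp: span_insert [of "(\<beta>, \<gamma>)"])
    then obtain a b where "Y - t *\<^sub>R (\<beta>, \<gamma>) = (a *\<^sub>R c, b *\<^sub>R c)"
      unfolding span_axes by blast
    then have "Y = (a *\<^sub>R c, b *\<^sub>R c) + t *\<^sub>R (\<beta>, \<gamma>)"
      by (simp only: diff_eq_eq)
    then have "Y = (a *\<^sub>R c + t *\<^sub>R \<beta>, b *\<^sub>R c + t *\<^sub>R \<gamma>)"
      by simp
    then show ?thesis by blast
  qed
  show "v \<in> complement_in_tangent T \<iota> (D1 T \<iota>) x \<longleftrightarrow> (\<exists>t. v = t *\<^sub>R frame (\<iota> x) (\<beta>, \<gamma>))"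
  proof
    assume "v \<in> complement_in_tangent T \<iota> (D1 T \<iota>) x"
    then have v: "v \<in> tangent T \<iota> x" "\<And>w. w \<in> D1 T \<iota> x \<Longrightarrow> nk_g (\<iota> x) v w = 0"
      by (auto simp: complement_in_tangent_def)
    then obtain N where N: "v = frame (\<iota> x) N"
      using T(1) by (auto simp: tangent_S3S3_eq_frame)
    then obtain a b t where abt: "N = (a *\<^sub>R c + t *\<^sub>R \<beta>, b *\<^sub>R c + t *\<^sub>R \<gamma>)"
      using Y v(1) by blast
    have "g0 N s = 0" if "s \<in> span ?S" for s
      using v(2) [of "frame (\<iota> x) s"] that Sm [of s] by (simp add: N nk_g_frame z)
    from this [of "(c, 0)"] this [of "(0, c)"]
    have "g0 N (c, 0) = 0" "g0 N (0, c) = 0"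
      by (simp_all add: span_base)
    \<comment> \<open>Up to a common factor, the coefficients form the Gram matrix of (c, 0) and (0,
      c) under \<open>g0\<close>, which is invertible.\<close>
    then have "(4 * a - 2 * b) * (c \<bullet> c) = 0" "(4 * b - 2 * a) * (c \<bullet> c) = 0"
      using X(2,3) by (simp_all add: abt g0_def inner_add_left inner_commute [of \<beta> c]
          inner_commute [of \<gamma> c] algebra_simps)
    then have "a = 0" "b = 0"
      using D(2) by simp_all
    then have "v = t *\<^sub>R frame (\<iota> x) (\<beta>, \<gamma>)"
      by (simp add: N abt flip: linear_scale [OF linear_frame])
    then show "\<exists>t. v = t *\<^sub>R frame (\<iota> x) (\<beta>, \<gamma>)" ..
  next
    assume "\<exists>t. v = t *\<^sub>R frame (\<iota> x) (\<beta>, \<gamma>)"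
    then obtain t where t: "v = t *\<^sub>R frame (\<iota> x) (\<beta>, \<gamma>)" ..
    have "nk_g (\<iota> x) v w = 0" if "w \<in> D1 T \<iota> x" for w
    proof -
      have "w \<in> tangent_S3S3 (\<iota> x)"
        using that T(1) by (auto simp: D1_def)
      then obtain s where s: "w = frame (\<iota> x) s"
        by (auto simp: tangent_S3S3_eq_frame)
      then have "s \<in> span ?S" using that Sm by blast
      then obtain a b where "s = (a *\<^sub>R c, b *\<^sub>R c)"
        unfolding span_axes by blast
      then show ?thesis
        using X(2,3) by (simp add: s t nk_g_simps nk_g_frame z g0_def inner_commute [of \<beta> c] inner_commute [of \<gamma> c])
    qed
    then show "v \<in> complement_in_tangent T \<iota> (D1 T \<iota>) x"
      using T(2) X(1) by (auto simp: complement_in_tangent_def t subspace_scale)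
  qed
qed

section \<open>The angle condition imposed by P on the complement of \<open>D1\<close>\<close>

context nk_connection
begin

lemma complement_angle:
  assumes z: "\<iota> x \<in> S3S3"
    and T: "tangent T \<iota> x \<subseteq> tangent_S3S3 (\<iota> x)" "subspace (tangent T \<iota> x)" "dim (tangent T \<iota> x) = 3"
    and D: "frame (\<iota> x) -` D1 T \<iota> x = span {(c, 0), (0, c)}" "c \<noteq> 0"
    and P: "nk_P (\<iota> x) ` D2 T \<iota> x = D3 nabla T \<iota> x"
    and X: "frame (\<iota> x) (\<beta>, \<gamma>) \<in> tangent T \<iota> x" "c \<bullet> \<beta> = 0" "c \<bullet> \<gamma> = 0" "(\<beta>, \<gamma>) \<noteq> 0"
  shows "\<beta> \<bullet> \<beta> = \<gamma> \<bullet> \<gamma>" "2 * (\<beta> \<bullet> \<gamma>) = \<beta> \<bullet> \<beta>"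
proof -
  let ?z = "\<iota> x" let ?X = "frame ?z (\<beta>, \<gamma>)"
  note compl = complement_subset_line(2) [OF z T D X]
  have D2: "\<exists>a b. v = a *\<^sub>R ?X + b *\<^sub>R nk_J ?z ?X" if v: "v \<in> D2 T \<iota> x" for v
  proof -
    obtain s t where "v = s *\<^sub>R ?X + nk_J ?z (t *\<^sub>R ?X)"
      using v unfolding D2_def compl by blast
    then show ?thesis
      by (auto simp: linear_scale [OF linear_nk_J])
  qed
  have XD2: "?X \<in> D2 T \<iota> x"
    unfolding D2_def compl
    by (rule CollectI, rule exI [of _ ?X], rule exI [of _ "0 *\<^sub>R ?X"])
      (auto simp: linear_0 [OF linear_nk_J] intro: exI [of _ 1] exI [of _ 0])
  \<comment> \<open>A generator of \<open>D3\<close> has its second argument in \<open>D2\<close>, a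
    combination of X and JX at the point, so \<open>nk_G_orthogonal_line\<close> applies.
    Orthogonality then extends to the span by linearity.\<close>
  have perp: "nk_g ?z w ?X = 0 \<and> nk_g ?z w (nk_J ?z ?X) = 0" if "w \<in> D3 nabla T \<iota> x" for w
    using that unfolding D3_def
  proof (rule span_induct [where P = "\<lambda>w. nk_g ?z w ?X = 0 \<and> nk_g ?z w (nk_J ?z ?X) = 0"])
    fix w
    assume "w \<in> {nk_G nabla X Y ?z | X Y. X \<in> vector_fields \<and> Y \<in> vector_fields \<and>
        X ?z \<in> D1 T \<iota> x \<and> Y ?z \<in> D2 T \<iota> x}"
    then obtain X' Y where "w = nk_G nabla X' Y ?z" "X' \<in> vector_fields" "Y \<in> vector_fields" "Y ?z \<in> D2 T \<iota> x"
      by blast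
    moreover obtain a b where "Y ?z = a *\<^sub>R ?X + b *\<^sub>R nk_J ?z ?X"
      using D2 [OF \<open>Y ?z \<in> D2 T \<iota> x\<close>] by blast
    ultimately show "nk_g ?z w ?X = 0 \<and> nk_g ?z w (nk_J ?z ?X) = 0"
      using nk_G_orthogonal_line z by simp
  next
    show "subspace {w. nk_g ?z w ?X = 0 \<and> nk_g ?z w (nk_J ?z ?X) = 0}"
      using nk_g_simps(3) [of ?z 0 0] by (simp add: subspace_def nk_g_simps)
  qed
  have "nk_P ?z ?X \<in> D3 nabla T \<iota> x"
    using XD2 P by blast
  from perp [OF this] have "g0 (\<gamma>, \<beta>) (\<beta>, \<gamma>) = 0" "g0 (\<gamma>, \<beta>) (J0 (\<beta>, \<gamma>)) = 0"
    using z by (simp_all add: nk_P_frame nk_J_frame nk_g_frame)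
  then have "4 * (\<beta> \<bullet> \<gamma>) = \<beta> \<bullet> \<beta> + \<gamma> \<bullet> \<gamma>" "\<beta> \<bullet> \<beta> = \<gamma> \<bullet> \<gamma>"
    by (simp_all add: g0_def J0_def inner_diff_left inner_diff_right inner_commute field_simps)
  then show "\<beta> \<bullet> \<beta> = \<gamma> \<bullet> \<gamma>" "2 * (\<beta> \<bullet> \<gamma>) = \<beta> \<bullet> \<beta>"
    by simp_all
qed

end

lemma Ck_on_subset: "Ck_on k f U \<Longrightarrow> V \<subseteq> U \<Longrightarrow> Ck_on k f V"
  by (induction k arbitrary: f) (auto intro: continuous_on_subset)

lemma smooth_on_subset: "smooth_on f U \<Longrightarrow> V \<subseteq> U \<Longrightarrow> smooth_on f V"
  unfolding smooth_on_def by (blast intro: Ck_on_subset)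

lemma coframe_differentiable:
  assumes "f differentiable at u" "g differentiable at u"
  shows "(\<lambda>u. coframe (f u) (g u)) differentiable at u"
  using bounded_bilinear.FDERIV [OF bilinear_conv_bounded_bilinear [THEN iffD1, OF bilinear_coframe]] assms
  unfolding differentiable_def by blast

section \<open>Comparison of \<open>D1\<close> with the CR distribution, and its rank\<close>

context nk_connection
begin

text \<open>The CR condition supplies an unspecified distribution D, while \<open>D1\<close> is
  defined from the tangent space alone. In the frame, the condition on the complement of D is
  exactly the hypothesis of \<open>maximal_J0_invariant_subspace\<close>.\<close>

lemma D1_eq:
  assumes z: "\<iota> x \<in> S3S3"
    and T: "tangent T \<iota> x \<subseteq> tangent_S3S3 (\<iota> x)" "subspace (tangent T \<iota> x)"
    and D: "subspace (D x)" "dim (D x) = 2" "D x \<subseteq> tangent T \<iota> x" "nk_J (\<iota> x) ` D x = D x"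
    and C: "nk_J (\<iota> x) ` complement_in_tangent T \<iota> D x \<subseteq> normal T \<iota> x"
  shows "D1 T \<iota> x = D x"
proof -
  let ?F = "frame (\<iota> x)"
  note V = dim_frame_vimage [OF z T]
  have DS: "D x \<subseteq> tangent_S3S3 (\<iota> x)" using T D by blast
  note S = dim_frame_vimage [OF z DS D(1)]
  have J: "?F -` (nk_J (\<iota> x) ` D x) = J0 ` (?F -` D x)"
    by (rule frame_vimage_nk_J [OF z DS])
  have "J0 ` (?F -` tangent T \<iota> x) \<inter> (?F -` tangent T \<iota> x) = ?F -` D x"
  proof (rule maximal_J0_invariant_subspace)
    fix n w
    assume n: "n \<in> ?F -` tangent T \<iota> x" "\<And>s. s \<in> ?F -` D x \<Longrightarrow> g0 n s = 0"
      and w: "w \<in> ?F -` tangent T \<iota> x"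
    have "nk_g (\<iota> x) (?F n) v = 0" if v: "v \<in> D x" for v
    proof -
      obtain s where "v = ?F s"
        using v DS by (auto simp: tangent_S3S3_eq_frame)
      then show ?thesis
        using n(2) v by (simp add: nk_g_frame z)
    qed
    then have "nk_J (\<iota> x) (?F n) \<in> normal T \<iota> x"
      using C n(1) unfolding complement_in_tangent_def by blast
    then show "g0 (J0 n) w = 0"
      using w by (auto simp: normal_def nk_J_frame nk_g_frame z)
  qed (use V S D J in auto)
  then have "?F -` D1 T \<iota> x = ?F -` D x"
    by (simp add: D1_def frame_vimage_nk_J z T)
  moreover have "D1 T \<iota> x \<subseteq> range ?F" "D x \<subseteq> range ?F"
    using T D by (auto simp: D1_def tangent_S3S3_eq_frame)
  ultimately show ?thesis
    by (metis image_vimage_eq inf.absorb1)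
qed

end

text \<open>A J-invariant line is impossible by \<open>J0_not_in_span\<close>, and rank 3 fills the
  tangent space.\<close>

lemma CR_distribution_rank:
  assumes z: "\<iota> x \<in> S3S3"
    and T: "tangent T \<iota> x \<subseteq> tangent_S3S3 (\<iota> x)" "subspace (tangent T \<iota> x)" "dim (tangent T \<iota> x) = 3"
    and D: "subspace (D x)" "D x \<subseteq> tangent T \<iota> x" "nk_J (\<iota> x) ` D x = D x"
  shows "dim (D x) = 0 \<and> D x = {0} \<or> dim (D x) = 2 \<or> D x = tangent T \<iota> x"
proof -
  have "dim (D x) \<noteq> 1"
  proof
    assume 1: "dim (D x) = 1"
    let ?S = "frame (\<iota> x) -` D x"
    have DS: "D x \<subseteq> tangent_S3S3 (\<iota> x)" using T D by blast
    note S = dim_frame_vimage [OF z DS D(1)]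
    obtain e where e: "e \<in> ?S" "e \<noteq> 0"
      using dim_pos_nonzero [of ?S] S(3) 1 by (metis zero_less_one)
    have "span {e} = ?S"
      using e S 1 by (intro subspace_dim_equal span_minimal) auto
    moreover have "J0 e \<in> ?S"
      using e(1) D(3) frame_vimage_nk_J [OF z DS] by (metis imageI)
    ultimately show False
      using J0_not_in_span [OF e(2)] by simp
  qed
  moreover have "dim (D x) \<le> 3"
    using dim_subset [OF D(2)] T(3) by simp
  moreover have "D x = tangent T \<iota> x" if "dim (D x) = 3"
    using that T D by (intro subspace_dim_equal) auto
  moreover have "D x = {0}" if "dim (D x) = 0"
    using that D(1) by (auto simp: subspace_0)
  ultimately show ?thesis
    by linarith
qed

section \<open>Nonexistence\<close>

lemma span_axes_scale:
  assumes "m \<noteq> 0"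
  shows "span {(m *\<^sub>R c, 0), (0, m *\<^sub>R c)} = span {(c, 0), (0, c)}"
proof -
  have "\<exists>a' b'. (a *\<^sub>R c, b *\<^sub>R c) = (a' *\<^sub>R m *\<^sub>R c, b' *\<^sub>R m *\<^sub>R c)" for a b
    using assms by (intro exI [of _ "a / m"] exI [of _ "b / m"]) simp
  then show ?thesis
    unfolding span_axes by (auto; metis scaleR_scaleR)
qed

section \<open>Contradiction from a local section of \<open>D1\<close>\<close>

context nk_connection
begin

text \<open>The section e provides a differentiable direction a of \<open>D1\<close> near
  \<open>u0\<close>, and from it a differentiable field (\<beta>, \<gamma>) in the complement. These
  are the data that \<open>no_moving_frame\<close> excludes.\<close>

lemma no_D1_section:
  assumes M: "submanifold3 T \<iota>" and p: "param T \<iota> U \<phi>" and u0: "u0 \<in> U"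
    and e: "smooth_on e U" "\<And>u. u \<in> U \<Longrightarrow> e u \<in> D1 T \<iota> (\<phi> u)" "e u0 \<noteq> 0"
    and D: "\<And>u. u \<in> U \<Longrightarrow> \<exists>c. c \<noteq> 0 \<and> frame (\<iota> (\<phi> u)) -` D1 T \<iota> (\<phi> u) = span {(c, 0), (0, c)}"
    and P: "\<And>u. u \<in> U \<Longrightarrow> nk_P (\<iota> (\<phi> u)) ` D2 T \<iota> (\<phi> u) = D3 nabla T \<iota> (\<phi> u)"
  shows False
proof -
  define f where "f = \<iota> \<circ> \<phi>"
  define A where "A u v = coframe (f u) (frechet_derivative f (at u) v)" for u v
  define E where "E u = coframe (f u) (e u)" for u
  \<comment> \<open>Both components of \<open>E u\<close> are multiples of the same vector. The
    choice of component is made once, at \<open>u0\<close>, so that a is differentiable in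
    u.\<close>
  define a where "a u = (if fst (E u0) \<noteq> 0 then fst (E u) else snd (E u))" for u
  define N where "N u = a u \<bullet> a u" for u
  note tf = param_tangent_facts [OF M p]
  have f: "smooth_on f U" and U: "open U"
    using p by (auto simp: param_def f_def)
  have fS: "f u \<in> S3S3" if "u \<in> U" for u
    using tf(2) that by (simp add: f_def)
  have f'_tan: "frechet_derivative f (at u) v \<in> tangent T \<iota> (\<phi> u)" if "u \<in> U" for u v
    unfolding tangent_param [OF p that] f_def by simp
  have frame_A: "frame (f u) (A u v) = frechet_derivative f (at u) v" if "u \<in> U" for u v
    using f'_tan [OF that, of v] tf(3) [OF that] fS [OF that]
    by (auto simp: A_def f_def intro: frame_coframe)
  have A_range: "\<exists>v. A u v = Y" if u: "u \<in> U" and Y: "frame (f u) Y \<in> tangent T \<iota> (\<phi> u)" for u Y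
  proof -
    obtain v where "frame (f u) Y = frechet_derivative f (at u) v"
      using Y unfolding tangent_param [OF p u] f_def by blast
    then have "A u v = Y"
      using coframe_frame [OF fS [OF u]] by (metis A_def)
    then show ?thesis ..
  qed
  have E: "frame (f u) (E u) = e u" if "u \<in> U" for u
    using e(2) [OF that] tf(3) [OF that] fS [OF that]
    by (auto simp: E_def f_def D1_def intro: frame_coframe)
  have df: "f differentiable at u" "e differentiable at u"
    "(\<lambda>u. frechet_derivative f (at u) v) differentiable at u" if "u \<in> U" for u v
  proof -
    have "Ck_on (Suc (Suc 0)) f U"
      using f by (simp add: smooth_on_def del: Ck_on.simps)
    then show "f differentiable at u" "(\<lambda>u. frechet_derivative f (at u) v) differentiable at u"
      using that by auto
    show "e differentiable at u"
      using e(1) that by (rule smooth_on_imp_differentiable)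
  qed
  have dE: "E differentiable at u" and dA: "(\<lambda>u. A u v) differentiable at u" if "u \<in> U" for u v
    unfolding E_def [abs_def] A_def using df that by (auto intro: coframe_differentiable)
  have da: "a differentiable at u" if "u \<in> U" for u
  proof -
    have "(\<lambda>u. fst (E u)) differentiable at u" "(\<lambda>u. snd (E u)) differentiable at u"
      using dE [OF that] has_derivative_fst has_derivative_snd unfolding differentiable_def by blast+
    then show ?thesis
      by (cases "fst (E u0) \<noteq> 0") (simp_all add: a_def [abs_def])
  qed
  have "E u0 \<noteq> 0"
    using E [OF u0] e(3) linear_0 [OF linear_frame] by metis
  then have a0: "a u0 \<noteq> 0"
    by (auto simp: a_def prod_eq_iff)
  define W where "W = U \<inter> a -` (- {0})"
  have "continuous_on U a"
    using da by (simp add: differentiable_imp_continuous_on differentiable_on_def differentiable_at_withinI)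
  then have W: "open W" "u0 \<in> W" "W \<subseteq> U"
    using a0 u0 U by (auto simp: W_def intro: continuous_open_preimage)
  have Da: "frame (\<iota> (\<phi> u)) -` D1 T \<iota> (\<phi> u) = span {(a u, 0), (0, a u)}" "a u \<noteq> 0" "N u \<noteq> 0" if "u \<in> W" for u
  proof -
    have u: "u \<in> U" "a u \<noteq> 0" using that by (auto simp: W_def)
    then show "a u \<noteq> 0" "N u \<noteq> 0" by (auto simp: N_def)
    obtain c where c: "frame (\<iota> (\<phi> u)) -` D1 T \<iota> (\<phi> u) = span {(c, 0), (0, c)}"
      using D u by blast
    have "E u \<in> frame (\<iota> (\<phi> u)) -` D1 T \<iota> (\<phi> u)"
      using E [OF u(1)] e(2) [OF u(1)] by (simp add: f_def)
    then obtain x y where "E u = (x *\<^sub>R c, y *\<^sub>R c)"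
      unfolding c span_axes by blast
    then obtain m where m: "a u = m *\<^sub>R c"
      by (metis a_def fst_conv snd_conv)
    then have "m \<noteq> 0" using u by auto
    then show "frame (\<iota> (\<phi> u)) -` D1 T \<iota> (\<phi> u) = span {(a u, 0), (0, a u)}"
      by (simp add: m c span_axes_scale)
  qed
  define V where "V u = frame (\<iota> (\<phi> u)) -` tangent T \<iota> (\<phi> u)" for u
  have V: "subspace (V u)" "dim (V u) = 3" "\<And>v. A u v \<in> V u" if "u \<in> U" for u
    using dim_frame_vimage(2,3) [OF tf(2-4)] tf(5) frame_A f'_tan that by (auto simp: V_def f_def)
  have DV: "span {(a u, 0), (0, a u)} \<subseteq> V u" if "u \<in> W" for u
    unfolding Da(1) [OF that, symmetric] V_def D1_def by blast
  have "\<not> V u0 \<subseteq> span {(a u0, 0), (0, a u0)}"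
    using dim_subset [of "V u0" "span {(a u0, 0), (0, a u0)}"] V(2) [OF u0] dim_axes [OF a0] by auto
  then obtain Y where Y: "Y \<in> V u0" "Y \<notin> span {(a u0, 0), (0, a u0)}" by blast
  \<comment> \<open>The constant parameter direction \<open>v0\<close> extends the tangent vector Y,
    which lies outside \<open>D1\<close>, to a tangent field on U.\<close>
  obtain v0 where v0: "A u0 v0 = Y"
    using A_range [OF u0, of Y] Y(1) by (auto simp: V_def f_def)
  \<comment> \<open>The projection orthogonal to a, multiplied by |a|^2 to avoid a division.\<close>
  define \<beta> where "\<beta> u = N u *\<^sub>R fst (A u v0) - (fst (A u v0) \<bullet> a u) *\<^sub>R a u" for u
  define \<gamma> where "\<gamma> u = N u *\<^sub>R snd (A u v0) - (snd (A u v0) \<bullet> a u) *\<^sub>R a u" for u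
  have orth: "a u \<bullet> \<beta> u = 0" "a u \<bullet> \<gamma> u = 0" for u
    by (simp_all add: \<beta>_def \<gamma>_def N_def inner_diff_right inner_commute)
  have \<beta>\<gamma>: "(\<beta> u, \<gamma> u) = N u *\<^sub>R A u v0 - ((fst (A u v0) \<bullet> a u) *\<^sub>R a u, (snd (A u v0) \<bullet> a u) *\<^sub>R a u)" for u
    by (simp add: \<beta>_def \<gamma>_def prod_eq_iff)
  have X: "frame (\<iota> (\<phi> u)) (\<beta> u, \<gamma> u) \<in> tangent T \<iota> (\<phi> u)" if "u \<in> W" for u
  proof -
    have "((fst (A u v0) \<bullet> a u) *\<^sub>R a u, (snd (A u v0) \<bullet> a u) *\<^sub>R a u) \<in> V u"
      using DV [OF that] unfolding span_axes by blast
    then have "(\<beta> u, \<gamma> u) \<in> V u"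
      unfolding \<beta>\<gamma> using V W that by (blast intro: subspace_diff subspace_scale)
    then show ?thesis by (simp add: V_def)
  qed
  have d\<beta>\<gamma>: "\<beta> differentiable at u0" "\<gamma> differentiable at u0"
  proof -
    have "(\<lambda>u. fst (A u v0)) differentiable at u0" "(\<lambda>u. snd (A u v0)) differentiable at u0"
      using dA [OF u0, of v0] has_derivative_fst has_derivative_snd unfolding differentiable_def by blast+
    then show "\<beta> differentiable at u0" "\<gamma> differentiable at u0"
      unfolding \<beta>_def [abs_def] \<gamma>_def [abs_def] N_def
      using da [OF u0] by (auto intro!: differentiable_diff differentiable_scaleR differentiable_inner)
  qed
  \<comment> \<open>The field (\<beta>, \<gamma>) may vanish at points of W other than
    \<open>u0\<close>. There the equations hold trivially, so they hold on all of the open set W and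
    can be differentiated.\<close>
  have norms: "\<beta> u \<bullet> \<beta> u = \<gamma> u \<bullet> \<gamma> u \<and> 2 * (\<beta> u \<bullet> \<gamma> u) = \<beta> u \<bullet> \<beta> u" if "u \<in> W" for u
  proof (cases "(\<beta> u, \<gamma> u) = 0")
    case False
    have "u \<in> U" using that W by blast
    from complement_angle [OF tf(2-5) [OF this] Da(1,2) [OF that] P [OF this] X [OF that] orth False]
    show ?thesis by blast
  qed (simp add: zero_prod_def)
  have A_cases: "(\<beta> u, \<gamma> u) = 0 \<or> (\<exists>x y t. A u v = (x *\<^sub>R a u + t *\<^sub>R \<beta> u, y *\<^sub>R a u + t *\<^sub>R \<gamma> u))"
    if "u \<in> W" for u v
  proof (cases "(\<beta> u, \<gamma> u) = 0")
    case False
    have u: "u \<in> U" using that W by blast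
    have "frame (\<iota> (\<phi> u)) (A u v) \<in> tangent T \<iota> (\<phi> u)"
      using V(3) [OF u] by (simp add: V_def)
    from complement_subset_line(1) [OF tf(2-5) [OF u] Da(1,2) [OF that] X [OF that] orth False this]
    show ?thesis by blast
  qed simp
  have h: "fst (A u v) \<bullet> (2 *\<^sub>R \<gamma> u - \<beta> u) = 0 \<and> snd (A u v) \<bullet> (\<gamma> u - 2 *\<^sub>R \<beta> u) = 0 \<and>
      fst (A u v) \<bullet> \<beta> u - snd (A u v) \<bullet> \<gamma> u = 0" if "u \<in> W" for u v
    using A_cases [OF that, of v]
  proof
    assume "\<exists>x y t. A u v = (x *\<^sub>R a u + t *\<^sub>R \<beta> u, y *\<^sub>R a u + t *\<^sub>R \<gamma> u)"
    then obtain x y t where "A u v = (x *\<^sub>R a u + t *\<^sub>R \<beta> u, y *\<^sub>R a u + t *\<^sub>R \<gamma> u)" by blast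
    moreover have "t * (2 * (\<beta> u \<bullet> \<gamma> u)) = t * (\<beta> u \<bullet> \<beta> u)" "t * (\<gamma> u \<bullet> \<gamma> u) = t * (\<beta> u \<bullet> \<beta> u)"
      using norms [OF that] by simp_all
    ultimately show ?thesis
      by (auto simp: inner_add_left inner_diff_right orth inner_commute [of "\<gamma> u" "\<beta> u"])
  qed (simp add: zero_prod_def)
  have "\<exists>v. A u0 v = Z" if "Z \<in> V u0" for Z
    using A_range [OF u0, of Z] that by (simp add: V_def f_def)
  moreover have "(a u0, 0) \<in> V u0" "(0, a u0) \<in> V u0" "(\<beta> u0, \<gamma> u0) \<in> V u0"
    using DV [OF W(2)] span_superset [of "{(a u0, 0), (0, a u0)}"] X [OF W(2)] by (auto simp: V_def)
  ultimately obtain v1 v2 v3 where v: "A u0 v1 = (a u0, 0)" "A u0 v2 = (0, a u0)" "A u0 v3 = (\<beta> u0, \<gamma> u0)"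
    by metis
  \<comment> \<open>By the equal norms \<gamma> would vanish as well; then Y would equal its own
    projection to the span of (a, 0) and (0, a), against its choice.\<close>
  have ne: "\<beta> u0 \<noteq> 0"
  proof
    assume "\<beta> u0 = 0"
    then have "(\<beta> u0, \<gamma> u0) = 0"
      using norms [OF W(2)] by (simp add: zero_prod_def)
    then have "N u0 *\<^sub>R Y = ((fst Y \<bullet> a u0) *\<^sub>R a u0, (snd Y \<bullet> a u0) *\<^sub>R a u0)"
      unfolding \<beta>\<gamma> v0 by simp
    then have "N u0 *\<^sub>R Y \<in> span {(a u0, 0), (0, a u0)}"
      unfolding span_axes by blast
    then have "inverse (N u0) *\<^sub>R N u0 *\<^sub>R Y \<in> span {(a u0, 0), (0, a u0)}"
      by (rule span_scale)
    with Y(2) Da(3) [OF W(2)] show False by simp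
  qed
  show False
  proof (rule no_moving_frame [where A = A and \<beta> = \<beta> and \<gamma> = \<gamma>, OF smooth_on_subset [OF f W(3)] W(1,2)])
    show "frechet_derivative f (at u0) v \<in> tangent_S3S3 (f u0)" for v
      using f'_tan [OF u0] tf(3) [OF u0] by (auto simp: f_def)
    show "(\<beta> has_derivative frechet_derivative \<beta> (at u0)) (at u0)"
      "(\<gamma> has_derivative frechet_derivative \<gamma> (at u0)) (at u0)"
      using d\<beta>\<gamma> by (simp_all add: frechet_derivative_works)
    show "A u v = coframe (f u) (frechet_derivative f (at u) v)" for u v
      by (rule A_def)
    show "A u0 v1 = (a u0, 0)" "A u0 v2 = (0, a u0)" "A u0 v3 = (\<beta> u0, \<gamma> u0)"
      by (fact v)+
  qed (use fS W(3) h norms a0 orth ne in auto)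
qed

end

theorem theorem1:
  fixes nabla :: connection
  assumes "levi_civita nabla"
  shows "\<not> (\<exists>(T :: 'm topology) (\<iota> :: 'm \<Rightarrow> quat2).
            proper_CR_submanifold T \<iota> \<and>
            (\<forall>x\<in>topspace T.
               nk_P (\<iota> x) ` D1 T \<iota> x = D1 T \<iota> x \<and>
               nk_P (\<iota> x) ` D2 T \<iota> x = D3 nabla T \<iota> x))"
proof
  interpret nk_connection nabla
    using assms by unfold_locales
  assume "\<exists>(T :: 'm topology) (\<iota> :: 'm \<Rightarrow> quat2).
            proper_CR_submanifold T \<iota> \<and>
            (\<forall>x\<in>topspace T.
               nk_P (\<iota> x) ` D1 T \<iota> x = D1 T \<iota> x \<and>
               nk_P (\<iota> x) ` D2 T \<iota> x = D3 nabla T \<iota> x)"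
  then obtain T :: "'m topology" and \<iota> :: "'m \<Rightarrow> quat2" where proper: "proper_CR_submanifold T \<iota>"
    and PD: "\<forall>x\<in>topspace T. nk_P (\<iota> x) ` D1 T \<iota> x = D1 T \<iota> x \<and>
      nk_P (\<iota> x) ` D2 T \<iota> x = D3 nabla T \<iota> x"
    by (elim exE conjE)
  from PD have P: "\<And>x. x \<in> topspace T \<Longrightarrow> nk_P (\<iota> x) ` D1 T \<iota> x = D1 T \<iota> x"
      "\<And>x. x \<in> topspace T \<Longrightarrow> nk_P (\<iota> x) ` D2 T \<iota> x = D3 nabla T \<iota> x"
    by simp_all
  have M: "submanifold3 T \<iota>" and ac: "\<not> almost_complex T \<iota>" and tr: "\<not> totally_real T \<iota>"
    using proper by (simp_all add: proper_CR_submanifold_def CR_submanifold_def)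
  obtain D where D: "smooth_distribution T \<iota> D"
    and JC: "\<forall>x\<in>topspace T. nk_J (\<iota> x) ` D x = D x \<and>
      nk_J (\<iota> x) ` complement_in_tangent T \<iota> D x \<subseteq> normal T \<iota> x"
    using proper unfolding proper_CR_submanifold_def CR_submanifold_def by (elim exE conjE)
  from JC have J: "\<And>x. x \<in> topspace T \<Longrightarrow> nk_J (\<iota> x) ` D x = D x"
    and C: "\<And>x. x \<in> topspace T \<Longrightarrow> nk_J (\<iota> x) ` complement_in_tangent T \<iota> D x \<subseteq> normal T \<iota> x"
    by simp_all
  have tf: "\<iota> x \<in> S3S3" "tangent T \<iota> x \<subseteq> tangent_S3S3 (\<iota> x)"
    "subspace (tangent T \<iota> x)" "dim (tangent T \<iota> x) = 3" if x: "x \<in> topspace T" for x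
  proof -
    obtain U \<phi> where p: "param T \<iota> U \<phi>" and "x \<in> \<phi> ` U"
      using M x unfolding submanifold3_def by metis
    then obtain u where u: "u \<in> U" "x = \<phi> u" by blast
    show "\<iota> x \<in> S3S3" "tangent T \<iota> x \<subseteq> tangent_S3S3 (\<iota> x)"
      "subspace (tangent T \<iota> x)" "dim (tangent T \<iota> x) = 3"
      unfolding u(2) using param_tangent_facts(2-5) [OF M p u(1)] .
  qed
  from D obtain k where k: "\<And>x. x \<in> topspace T \<Longrightarrow> \<exists>U \<phi> (e :: nat \<Rightarrow> real^3 \<Rightarrow> quat2).
      param T \<iota> U \<phi> \<and> x \<in> \<phi> ` U \<and> (\<forall>i<k. smooth_on (e i) U) \<and>
      (\<forall>u\<in>U. D (\<phi> u) = span ((\<lambda>i. e i u) ` {..<k}) \<and> dim (D (\<phi> u)) = k \<and>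
              D (\<phi> u) \<subseteq> tangent T \<iota> (\<phi> u))"
    unfolding smooth_distribution_def by blast
  have Dx: "subspace (D x)" "D x \<subseteq> tangent T \<iota> x" "dim (D x) = k" if x: "x \<in> topspace T" for x
  proof -
    obtain U \<phi> and e :: "nat \<Rightarrow> real^3 \<Rightarrow> quat2" where "x \<in> \<phi> ` U"
      and *: "\<forall>u\<in>U. D (\<phi> u) = span ((\<lambda>i. e i u) ` {..<k}) \<and> dim (D (\<phi> u)) = k \<and>
              D (\<phi> u) \<subseteq> tangent T \<iota> (\<phi> u)"
      using k [OF x] by (elim exE conjE)
    then obtain u where u: "u \<in> U" "x = \<phi> u" by blast
    with * have "D x = span ((\<lambda>i. e i u) ` {..<k}) \<and> dim (D x) = k \<and> D x \<subseteq> tangent T \<iota> x"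
      by blast
    then show "subspace (D x)" "D x \<subseteq> tangent T \<iota> x" "dim (D x) = k"
      by (metis subspace_span, blast, blast)
  qed
  have rank: "k = 0 \<and> D x = {0} \<or> k = 2 \<or> D x = tangent T \<iota> x" if "x \<in> topspace T" for x
    using CR_distribution_rank [of \<iota> x T D] tf [OF that] Dx [OF that] J [OF that] by auto
  \<comment> \<open>The rank is constant over T, so the degenerate alternatives hold globally: D = 0
    makes the submanifold totally real and D equal to the tangent spaces makes it almost complex.
    Properness excludes both.\<close>
  have "k = 2"
  proof (rule ccontr)
    assume "k \<noteq> 2"
    then consider "\<And>x. x \<in> topspace T \<Longrightarrow> D x = {0}" | "\<And>x. x \<in> topspace T \<Longrightarrow> D x = tangent T \<iota> x"
      using rank Dx(3) tf(4) by (metis zero_neq_numeral)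
    then show False
    proof cases
      case 1
      then have "complement_in_tangent T \<iota> D x = tangent T \<iota> x" if "x \<in> topspace T" for x
        using that nk_g_simps(7) [of "\<iota> x" _ 0 0] by (auto simp: complement_in_tangent_def)
      with C tr show False by (simp add: totally_real_def)
    next
      case 2
      with J ac show False by (simp add: almost_complex_def)
    qed
  qed
  have D1: "D1 T \<iota> x = D x" if "x \<in> topspace T" for x
    using D1_eq [of \<iota> x T D] tf [OF that] Dx [OF that] J [OF that] C [OF that] \<open>k = 2\<close> by simp
  have plane: "\<exists>c. c \<noteq> 0 \<and> frame (\<iota> x) -` D1 T \<iota> x = span {(c, 0), (0, c)}" if x: "x \<in> topspace T" for x
  proof -
    have DS: "D x \<subseteq> tangent_S3S3 (\<iota> x)"
      using tf [OF x] Dx [OF x] by blast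
    note S = dim_frame_vimage(2,3) [OF tf(1) [OF x] DS Dx(1) [OF x]]
    have inv: "J0 ` (frame (\<iota> x) -` D x) = frame (\<iota> x) -` D x"
      "prod.swap ` (frame (\<iota> x) -` D x) = frame (\<iota> x) -` D x"
      using frame_vimage_nk_J [OF tf(1) [OF x] DS] frame_vimage_nk_P [OF tf(1) [OF x] DS]
        J [OF x] P(1) [OF x] D1 [OF x] by simp_all
    obtain c where "c \<noteq> 0" "frame (\<iota> x) -` D x = span {(c, 0), (0, c)}"
      by (rule J0_swap_invariant_plane [of "frame (\<iota> x) -` D x"])
        (use S inv Dx(3) [OF x] \<open>k = 2\<close> in simp_all)
    then show ?thesis
      using D1 [OF x] by auto
  qed
  \<comment> \<open>An empty submanifold would be vacuously totally real.\<close>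
  obtain x where x: "x \<in> topspace T"
    using tr by (auto simp: totally_real_def)
  obtain U \<phi> and e :: "nat \<Rightarrow> real^3 \<Rightarrow> quat2" where p: "param T \<iota> U \<phi>" "x \<in> \<phi> ` U"
    and e: "\<forall>i<k. smooth_on (e i) U"
    and De': "\<forall>u\<in>U. D (\<phi> u) = span ((\<lambda>i. e i u) ` {..<k}) \<and> dim (D (\<phi> u)) = k \<and>
              D (\<phi> u) \<subseteq> tangent T \<iota> (\<phi> u)"
    using k [OF x] by (elim exE conjE)
  then have De: "D (\<phi> u) = span ((\<lambda>i. e i u) ` {..<2})" if "u \<in> U" for u
    using that \<open>k = 2\<close> by simp
  obtain u where u: "u \<in> U" "x = \<phi> u" using p(2) by blast
  have top: "\<phi> u \<in> topspace T" if "u \<in> U" for u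
    using param_tangent_facts(1) [OF M p(1) that] .
  have "(\<lambda>i. e i u) ` {..<2} = {e 0 u, e 1 u}"
    by (auto simp: numeral_2_eq_2 lessThan_Suc)
  then have "dim {e 0 u, e 1 u} = 2"
    using Dx(3) [OF x] De [OF u(1)] u(2) \<open>k = 2\<close> by simp
  \<comment> \<open>Two vectors spanning a plane are both nonzero, so the first local generator of D
    serves as the section of \<open>D1\<close>.\<close>
  then have "e 0 u \<noteq> 0"
    by (auto simp: dim_insert span_zero split: if_splits)
  moreover have "e 0 u \<in> D1 T \<iota> (\<phi> u)" if "u \<in> U" for u
    using D1 [OF top [OF that]] De [OF that] by (auto intro: span_base)
  ultimately show False
    using no_D1_section [OF M p(1) u(1), of "e 0"] e \<open>k = 2\<close> plane top P(2) by auto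
qed

end
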